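(* Let $q=p^n$ be a power of a prime $p$, let $K$ be a function field of one variable with constant field $\mathbb{F}_q$, of genus $g$, and let $\infty$ be a place of $K$ of degree $1$. Suppose that $K$ has an $r$-gap structure at $\infty$ with $r\ge q-1$. Let $A$ be the ring of elements of $K$ with no poles outside $\infty$. Then for every positive integer $s$ that is a multiple of $q-1$ and satisfies $\frac{l_q(s)}{q-1}\le r$, the order of vanishing of $\zeta_A$ at $-s$, i.e. the order of vanishing of $\zeta_A(-s,X)$ at $X=1$, is equal to $q$.
   Context: For a divisor $D$ of $K$, $l(D)=\dim_{\mathbb{F}_q}\mathcal{L}(D)$. $K$ (of genus $g$) has an $r$-gap structure at $\infty$ if $l(iq\infty)=i+1$ for $1\le i\le r$, $l((g+r)\infty)=r+1$, and $rq\le g+r$. For a nonnegative integer $k=\sum_i k_iq^i$ with $0\le k_i<q$, $l_q(k)=\sum_i k_i$ is the sum of the base-$q$ digits of $k$. For $a\in K$, $\deg(a)=-v_\infty(a)$. Fix a uniformizer $u_\infty$ at $\infty$, so that the completion is $K_\infty=\mathbb{F}_q((u_\infty))$; a nonzero element is monic if its leading coefficient (the coefficient of the lowest power of $u_\infty$) is $1$. For an integer $t$, define $$\zeta_A(t,X)=\sum_{d=0}^\infty X^d\sum_{\substack{a\in A,\ \deg a=d\\ a\text{ monic}}}\frac{1}{a^{t}}\in K[[X]].$$ For $t=-s$ with $s$ a positive integer, only finitely many coefficients are nonzero, so $\zeta_A(-s,X)$ is a polynomial in $X$. The order of vanishing of $\zeta_A$ at $-s$ is defined as the order of vanishing of $\zeta_A(-s,X)$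 at $X=1$. *)

theory Defs
  imports "HOL-Computational_Algebra.Computational_Algebra"
begin

text \<open>
  A function field is given by a field homomorphism \<open>\<iota> :: 'k \<Rightarrow> 'a\<close> from its constant field
  into the field itself. Fields being simple, \<open>\<iota>\<close> is injective.
\<close>

definition rational_subfield :: "('k::field \<Rightarrow> 'a::field) \<Rightarrow> 'a \<Rightarrow> 'a set" where
  "rational_subfield \<iota> x =
     {poly (map_poly \<iota> P) x / poly (map_poly \<iota> Q) x | P Q. poly (map_poly \<iota> Q) x \<noteq> 0}"

definition algebraic_over :: "('k::field \<Rightarrow> 'a::field) \<Rightarrow> 'a \<Rightarrow> bool" where
  "algebraic_over \<iota> x \<longleftrightarrow> (\<exists>P. P \<noteq> 0 \<and> poly (map_poly \<iota> P) x = 0)"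

locale function_field =
  fixes \<iota> :: "'k::field \<Rightarrow> 'a::field"
  assumes emb_one: "\<iota> 1 = 1"
    and emb_add: "\<iota> (c + d) = \<iota> c + \<iota> d"
    and emb_mult: "\<iota> (c * d) = \<iota> c * \<iota> d"
    and finite_over_rational:
      "\<exists>x. \<not> algebraic_over \<iota> x \<and>
        (\<exists>B. finite B \<and> (\<forall>y. \<exists>c. (\<forall>b\<in>B. c b \<in> rational_subfield \<iota> x) \<and> y = (\<Sum>b\<in>B. c b * b)))"
    and constant_field: "algebraic_over \<iota> y \<Longrightarrow> y \<in> range \<iota>"

abbreviation scalar :: "('k::field \<Rightarrow> 'a::field) \<Rightarrow> 'k \<Rightarrow> 'a \<Rightarrow> 'a" where
  "scalar \<iota> \<equiv> (\<lambda>c x. \<iota> c * x)"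

lemma (in function_field) vector_space_scalar: "vector_space (scalar \<iota>)"
  by unfold_locales (simp_all add: emb_one emb_add emb_mult algebra_simps)


text \<open>
  Places are represented by their normalized discrete valuations. The value at 0 (mathematically
  \<open>\<infinity>\<close>) is set to the dummy value 0, so that distinct functions are distinct places; every use
  below treats 0 separately or is insensitive to it.
\<close>

definition places :: "('k::field \<Rightarrow> 'a::field) \<Rightarrow> ('a \<Rightarrow> int) set" where
  "places \<iota> = {v.
     v 0 = 0 \<and>
     (\<forall>c. c \<noteq> 0 \<longrightarrow> v (\<iota> c) = 0) \<and>
     (\<forall>x y. x \<noteq> 0 \<longrightarrow> y \<noteq> 0 \<longrightarrow> v (x * y) = v x + v y) \<and>
     (\<forall>x y. x \<noteq> 0 \<longrightarrow> y \<noteq> 0 \<longrightarrow> x + y \<noteq> 0 \<longrightarrow> min (v x) (v y) \<le> v (x + y)) \<and>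
     (\<exists>x. x \<noteq> 0 \<and> v x = 1)}"

definition val_ge :: "('a::field \<Rightarrow> int) \<Rightarrow> 'a \<Rightarrow> int \<Rightarrow> bool" where
  "val_ge v x m \<longleftrightarrow> x = 0 \<or> m \<le> v x"

text \<open>A finite set of representatives of a basis of the residue field over the constants.\<close>

definition residue_basis :: "('k::field \<Rightarrow> 'a::field) \<Rightarrow> ('a \<Rightarrow> int) \<Rightarrow> 'a set \<Rightarrow> bool" where
  "residue_basis \<iota> v B \<longleftrightarrow>
     finite B \<and> (\<forall>b\<in>B. val_ge v b 0) \<and>
     (\<forall>c. val_ge v (\<Sum>b\<in>B. \<iota> (c b) * b) 1 \<longrightarrow> (\<forall>b\<in>B. c b = 0)) \<and>
     (\<forall>x. val_ge v x 0 \<longrightarrow> (\<exists>c. val_ge v (x - (\<Sum>b\<in>B. \<iota> (c b) * b)) 1))"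

definition place_degree :: "('k::field \<Rightarrow> 'a::field) \<Rightarrow> ('a \<Rightarrow> int) \<Rightarrow> nat" where
  "place_degree \<iota> v =
     (if \<exists>B. residue_basis \<iota> v B then card (SOME B. residue_basis \<iota> v B) else 0)"

definition divisors :: "('k::field \<Rightarrow> 'a::field) \<Rightarrow> (('a \<Rightarrow> int) \<Rightarrow> int) set" where
  "divisors \<iota> = {D. finite {v. D v \<noteq> 0} \<and> {v. D v \<noteq> 0} \<subseteq> places \<iota>}"

definition divisor_degree :: "('k::field \<Rightarrow> 'a::field) \<Rightarrow> (('a \<Rightarrow> int) \<Rightarrow> int) \<Rightarrow> int" where
  "divisor_degree \<iota> D = (\<Sum>v | D v \<noteq> 0. D v * int (place_degree \<iota> v))"

definition multiple_of_place :: "int \<Rightarrow> ('a \<Rightarrow> int) \<Rightarrow> ('a \<Rightarrow> int) \<Rightarrow> int" where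
  "multiple_of_place m v = (\<lambda>v'. if v' = v then m else 0)"

definition riemann_roch_space ::
    "('k::field \<Rightarrow> 'a::field) \<Rightarrow> (('a \<Rightarrow> int) \<Rightarrow> int) \<Rightarrow> 'a set" where
  "riemann_roch_space \<iota> D = {f. \<forall>v\<in>places \<iota>. val_ge v f (- D v)}"

definition ell :: "('k::field \<Rightarrow> 'a::field) \<Rightarrow> (('a \<Rightarrow> int) \<Rightarrow> int) \<Rightarrow> nat" where
  "ell \<iota> D = vector_space.dim (scalar \<iota>) (riemann_roch_space \<iota> D)"

text \<open>The genus is the maximum of \<open>deg D - l(D) + 1\<close> over all divisors \<open>D\<close>.\<close>

definition has_genus :: "('k::field \<Rightarrow> 'a::field) \<Rightarrow> nat \<Rightarrow> bool" where
  "has_genus \<iota> g \<longleftrightarrow>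
     (\<forall>D\<in>divisors \<iota>. divisor_degree \<iota> D - int (ell \<iota> D) + 1 \<le> int g) \<and>
     (\<exists>D\<in>divisors \<iota>. divisor_degree \<iota> D - int (ell \<iota> D) + 1 = int g)"

definition gap_structure ::
    "('k::field \<Rightarrow> 'a::field) \<Rightarrow> ('a \<Rightarrow> int) \<Rightarrow> nat \<Rightarrow> nat \<Rightarrow> nat \<Rightarrow> bool" where
  "gap_structure \<iota> w q g r \<longleftrightarrow>
     (\<forall>i\<in>{1..r}. ell \<iota> (multiple_of_place (int (i * q)) w) = i + 1) \<and>
     ell \<iota> (multiple_of_place (int (g + r)) w) = r + 1 \<and>
     r * q \<le> g + r"

definition integral_ring :: "('k::field \<Rightarrow> 'a::field) \<Rightarrow> ('a \<Rightarrow> int) \<Rightarrow> 'a set" where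
  "integral_ring \<iota> w = {a. \<forall>v\<in>places \<iota> - {w}. val_ge v a 0}"

text \<open>
  The image of \<open>a\<close> in the completion at the degree-one place \<open>w\<close>, identified with the Laurent series in the uniformizer \<open>u\<close>
  over the constant field, is \<open>f\<close>: the partial sums of \<open>f\<close> at \<open>u\<close> converge to \<open>a\<close>.
\<close>

definition has_expansion ::
    "('k::field \<Rightarrow> 'a::field) \<Rightarrow> ('a \<Rightarrow> int) \<Rightarrow> 'a \<Rightarrow> 'a \<Rightarrow> 'k fls \<Rightarrow> bool" where
  "has_expansion \<iota> w u a f \<longleftrightarrow>
     (\<forall>N. val_ge w (a - (\<Sum>i\<in>{fls_subdegree f..<N}. \<iota> (fls_nth f i) * u powi i)) N)"

definition is_monic :: "('k::field \<Rightarrow> 'a::field) \<Rightarrow> ('a \<Rightarrow> int) \<Rightarrow> 'a \<Rightarrow> 'a \<Rightarrow> bool" where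
  "is_monic \<iota> w u a \<longleftrightarrow>
     a \<noteq> 0 \<and> (\<exists>f. has_expansion \<iota> w u a f \<and> fls_nth f (fls_subdegree f) = 1)"

definition zeta ::
    "('k::field \<Rightarrow> 'a::field) \<Rightarrow> ('a \<Rightarrow> int) \<Rightarrow> 'a \<Rightarrow> int \<Rightarrow> 'a fps" where
  "zeta \<iota> w u t = Abs_fps (\<lambda>d.
     \<Sum>a | a \<in> integral_ring \<iota> w \<and> - w a = int d \<and> is_monic \<iota> w u a. 1 / a powi t)"

text \<open>
  The order of vanishing at \<open>X = 1\<close> of a power series that is in fact a nonzero polynomial.
\<close>

definition vanishing_order_at_1 :: "'a::field fps \<Rightarrow> nat \<Rightarrow> bool" where
  "vanishing_order_at_1 F m \<longleftrightarrow> (\<exists>Z. F = fps_of_poly Z \<and> Z \<noteq> 0 \<and> order 1 Z = m)"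

text \<open>For \<open>q \<ge> 2\<close> all base-\<open>q\<close> digits of \<open>k\<close> at positions \<open>i > k\<close> are 0.\<close>

definition digit_sum :: "nat \<Rightarrow> nat \<Rightarrow> nat" where
  "digit_sum q k = (\<Sum>i\<le>k. k div q ^ i mod q)"

end

theory Submission
  imports Defs
begin

text \<open>
  Let \<open>k\<close> be the constant field and \<open>A\<close> the ring of functions with poles only at \<open>\<infinity>\<close>, and call an
  integer a pole order if it is the degree of a nonzero element of \<open>A\<close>. The coefficient of
  \<open>X ^ d\<close> in the zeta function at \<open>- s\<close> is the sum of \<open>a ^ s\<close> over the monic \<open>a \<in> A\<close> of degree
  \<open>d\<close>. These form an affine subspace (\<open>monic_elements_translate\<close>), or the empty set if \<open>d\<close> is not a
  pole order.

  The gap structure counts pole orders: there are \<open>r + 1\<close> of them up to \<open>g + r\<close>, as many up to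
  \<open>r * q\<close>, and two up to \<open>q\<close>. Since they form a semigroup and \<open>r \<ge> q - 1\<close>, those up to \<open>g + r\<close>
  are exactly \<open>0, q, \<dots>, r * q\<close> (\<open>semigroup_of_multiples\<close>). Take \<open>x \<in> A\<close> monic of degree \<open>q\<close>. Then
  for \<open>i \<le> r\<close> the monic elements of degree \<open>i * q\<close> are the monic polynomials of degree \<open>i\<close>
  in \<open>x\<close> (\<open>sum_power_monic_elements_eq_eval_at\<close>). A degree \<open>d > g + r\<close> contributes nothing: if
  it is a pole order then the affine subspace has dimension at least \<open>r + 1\<close>, and the sum of
  \<open>s\<close>-th powers over an affine subspace of dimension \<open>m\<close> vanishes if the base-\<open>q\<close> digits of \<open>s\<close> add up to less than
  \<open>m * (q - 1)\<close> (\<open>sum_affine_power_eq_0\<close>).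

  The same vanishing result for \<open>k[T]\<close> shows that its power sums over the monic polynomials of
  degree greater than \<open>r\<close> are \<open>0\<close>. Hence the zeta function of \<open>A\<close> at \<open>- s\<close> is \<open>Y (X ^ q)\<close>, where
  \<open>Y\<close> is the image of the zeta function of \<open>k[T]\<close> at \<open>- s\<close> under \<open>T \<mapsto> x\<close>. For \<open>s\<close> divisible by
  \<open>q - 1\<close> the latter has a simple zero at \<open>X = 1\<close>: it vanishes there by
  \<open>sum_monic_power_sum_eq_0\<close>, and its derivative there is \<open>- 1\<close> modulo \<open>T\<close> by
  \<open>weighted_sum_monic_power_sum_neq_0\<close>. As \<open>x\<close> is transcendental, the zero stays simple under
  \<open>T \<mapsto> x\<close>. Substituting \<open>X ^ q\<close> multiplies its order by \<open>q\<close>, because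
  \<open>X ^ q - 1 = (X - 1) ^ q\<close> in characteristic \<open>p\<close>.
\<close>

section \<open>Power sums over finite fields\<close>

lemma power_card_minus_1_finite_field:
  fixes c :: "'k::{field,finite}"
  assumes "c \<noteq> 0"
  shows "c ^ (card (UNIV :: 'k set) - 1) = 1"
proof -
  have "(\<Prod>y\<in>UNIV-{0}. y) = (\<Prod>y\<in>UNIV-{0}. c * y)"
    by (rule prod.reindex_bij_witness[of _ "\<lambda>y. c * y" "\<lambda>y. y / c"]) (use assms in auto)
  also have "\<dots> = c ^ (card (UNIV :: 'k set) - 1) * (\<Prod>y\<in>UNIV-{0}. y)"
    by (simp add: prod.distrib card_Diff_singleton)
  finally show ?thesis by simp
qed

lemma power_card_finite_field:
  "(c :: 'k::{field,finite}) ^ card (UNIV :: 'k set) = c"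
proof (cases "c = 0")
  case True
  then show ?thesis
    using finite_UNIV_card_ge_0[where ?'a = 'k] by (simp add: zero_power)
next
  case False
  have "c ^ card (UNIV :: 'k set) = c * c ^ (card (UNIV :: 'k set) - 1)"
    using finite_UNIV_card_ge_0[where ?'a = 'k] by (simp flip: power_Suc)
  then show ?thesis
    using power_card_minus_1_finite_field[OF False] by simp
qed

lemma of_nat_card_finite_field: "of_nat (card (UNIV :: 'k::{field,finite} set)) = (0 :: 'k)"
proof -
  have "(\<Sum>c\<in>UNIV. c) = (\<Sum>c\<in>UNIV. c + (1::'k))"
    by (rule sum.reindex_bij_witness[of _ "\<lambda>c. c + 1" "\<lambda>c. c - 1"]) auto
  then show ?thesis by (simp add: sum.distrib)
qed

lemma two_le_card_finite_field: "2 \<le> card (UNIV :: 'k::{field,finite} set)"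
  using card_mono[of "UNIV :: 'k set" "{0, 1}"] by simp

text \<open>
  If \<open>q - 1\<close> does not divide \<open>j\<close> then some \<open>a \<noteq> 0\<close> has \<open>a ^ j \<noteq> 1\<close>, because
  \<open>X ^ (j mod (q - 1)) - 1\<close> has fewer than \<open>q - 1\<close> roots; substituting \<open>a * c\<close> for \<open>c\<close> multiplies
  the sum by \<open>a ^ j\<close>, so the sum is \<open>0\<close>. For \<open>j = 0\<close> the convention \<open>0 ^ 0 = 1\<close> makes the sum
  equal to \<open>q = 0\<close>.
\<close>
lemma sum_power_finite_field:
  "(\<Sum>c\<in>(UNIV :: 'k::{field,finite} set). c ^ j) =
     (if j > 0 \<and> (card (UNIV :: 'k set) - 1) dvd j then - 1 else 0)"
proof -
  let ?m = "card (UNIV :: 'k set) - 1"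
  have m: "?m > 0" using two_le_card_finite_field[where 'k = 'k] by simp
  consider "j = 0" | "j > 0" "?m dvd j" | "\<not> ?m dvd j" by auto
  then show ?thesis
  proof cases
    case 1
    then show ?thesis by (simp add: of_nat_card_finite_field)
  next
    case 2
    then obtain t where t: "j = ?m * t" by (elim dvdE)
    have "(\<Sum>c\<in>(UNIV :: 'k set). c ^ j) = (\<Sum>c\<in>UNIV - {0::'k}. c ^ j)"
      by (rule sum.mono_neutral_right) (use 2 in auto)
    also have "\<dots> = (\<Sum>c\<in>UNIV - {0::'k}. 1)"
      by (rule sum.cong) (auto simp: t power_mult power_card_minus_1_finite_field simp del: One_nat_def)
    also have "\<dots> = of_nat ?m" by (simp add: card_Diff_singleton)
    also have "\<dots> = - 1"
      using of_nat_card_finite_field[where 'k = 'k] two_le_card_finite_field[where 'k = 'k]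
      by (simp add: of_nat_diff)
    finally show ?thesis using 2 by simp
  next
    case 3
    define e where "e = j mod ?m"
    have e: "0 < e" "e < ?m" using 3 m by (auto simp: e_def mod_greater_zero_iff_not_dvd)
    have "\<exists>a::'k. a \<noteq> 0 \<and> a ^ e \<noteq> 1"
    proof (rule ccontr)
      assume *: "\<not> ?thesis"
      define P :: "'k poly" where "P = monom 1 e - 1"
      have "coeff P e = 1" using e by (simp add: P_def)
      then have "P \<noteq> 0" by auto
      have "degree P \<le> e" unfolding P_def
        by (rule degree_diff_le) (simp_all add: degree_monom_le)
      moreover have "UNIV - {0} \<subseteq> {a. poly P a = 0}"
        using * by (auto simp: P_def poly_monom)
      then have "?m \<le> card {a. poly P a = 0}"
        using card_mono[of "{a. poly P a = 0}" "UNIV - {0}"] by (simp add: card_Diff_singleton)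
      ultimately show False
        using card_poly_roots_bound[OF \<open>P \<noteq> 0\<close>] e by linarith
    qed
    then obtain a :: 'k where a: "a \<noteq> 0" "a ^ e \<noteq> 1" by blast
    have "a ^ j = a ^ (?m * (j div ?m) + e)" by (simp add: e_def)
    then have aj: "a ^ j \<noteq> 1"
      using a by (simp add: power_add power_mult power_card_minus_1_finite_field del: One_nat_def)
    have "(\<Sum>c\<in>(UNIV :: 'k set). c ^ j) = (\<Sum>c\<in>UNIV. (a * c) ^ j)"
      by (rule sum.reindex_bij_witness[of _ "\<lambda>c. a * c" "\<lambda>c. c / a"]) (use a in auto)
    also have "\<dots> = a ^ j * (\<Sum>c\<in>UNIV. c ^ j)"
      by (simp add: power_mult_distrib sum_distrib_left)
    finally have "(1 - a ^ j) * (\<Sum>c\<in>(UNIV :: 'k set). c ^ j) = 0" by (simp add: algebra_simps)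
    then show ?thesis using 3 aj by auto
  qed
qed

section \<open>Power sums over affine subspaces\<close>

lemma digit_expansion:
  fixes q k :: nat
  assumes "q \<ge> 2"
  shows "(\<Sum>i\<le>k. (k div q ^ i mod q) * q ^ i) = k"
proof -
  have "(\<Sum>i<m. (k div q ^ i mod q) * q ^ i) = k mod q ^ m" for m
  proof (induction m)
    case (Suc m)
    then show ?case using mod_mult2_eq[of k "q ^ m" q] by (simp add: mult.commute)
  qed simp
  moreover have "k < q ^ Suc k"
  proof -
    have "k < 2 ^ Suc k" by (meson lessI less_exp less_trans)
    also have "(2::nat) ^ Suc k \<le> q ^ Suc k" using assms by (rule power_mono) simp
    finally show ?thesis .
  qed
  ultimately show ?thesis by (metis lessThan_Suc_atMost mod_less)
qed

lemma (in vector_space) span_insert_eqI: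
  assumes "\<And>y. y \<in> V \<longleftrightarrow> (\<exists>c. y - scale c b \<in> span B)"
  shows "span (insert b B) = V"
  using assms by (auto simp: span_breakdown_eq)


locale finite_field_algebra = vector_space scale
  for scale :: "'k::{field,finite} \<Rightarrow> 'b::comm_ring_1 \<Rightarrow> 'b" +
  fixes p n q :: nat
  assumes scale_mult: "scale c (x * y) = scale c x * y"
    and prime_p: "prime p" and q_eq: "q = p ^ n"
    and card_constants: "card (UNIV :: 'k set) = q"
begin

lemma q_ge_2: "q \<ge> 2"
  using two_le_card_finite_field[where 'k = 'k] by (simp add: card_constants)

lemma scale_prod: "finite J \<Longrightarrow> (\<Prod>j\<in>J. scale c (y j)) = scale (c ^ card J) (\<Prod>j\<in>J. y j)"
proof (induction J rule: finite_induct)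
  case (insert j J)
  have "scale c (y j) * scale (c ^ card J) (prod y J) = scale (c ^ card J) (prod y J) * scale c (y j)"
    by (rule mult.commute)
  also have "\<dots> = scale (c ^ card J) (scale c (y j * prod y J))"
    by (metis scale_mult mult.commute)
  finally show ?case using insert by (simp add: mult.commute)
qed simp

lemma scale_power: "scale c x ^ m = scale (c ^ m) (x ^ m)"
  using scale_prod[of "{..<m}" c "\<lambda>_. x"] by simp

lemma CHAR_algebra: "CHAR('b) = p"
proof -
  have of_nat_scale: "of_nat m = scale (of_nat m) (1::'b)" for m
    by (induction m) (simp_all add: scale_left_distrib)
  have "of_nat q = (0::'b)"
    using of_nat_scale[of q] of_nat_card_finite_field[where 'k = 'k] by (simp add: card_constants)
  then have "CHAR('b) dvd p ^ n" unfolding of_nat_eq_0_iff_char_dvd q_eq .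
  then obtain i where i: "CHAR('b) = p ^ i"
    using prime_p by (auto simp: divides_primepow_nat)
  have "CHAR('k) dvd p ^ n"
    using of_nat_card_finite_field[where 'k = 'k]
    by (simp add: of_nat_eq_0_iff_char_dvd q_eq card_constants flip: of_nat_power)
  then have "CHAR('k) = p"
    using prime_CHAR_semidom[where 'a = 'k] finite_imp_CHAR_pos[where 'a = 'k] prime_p
    by (metis finite neq0_conv prime_dvd_power_nat primes_dvd_imp_eq)
  then have "of_nat p = (0::'k)" using of_nat_CHAR[where 'a = 'k] by simp
  then have "of_nat p = (0::'b)" using of_nat_scale[of p] by simp
  then have "CHAR('b) dvd p" by (simp add: of_nat_eq_0_iff_char_dvd)
  moreover have "CHAR('b) \<noteq> 1" using of_nat_CHAR[where 'a = 'b] by auto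
  ultimately show ?thesis using prime_p by (auto simp: prime_nat_iff)
qed

text \<open>
  The \<open>q\<close>-th power map is linear over the field with \<open>q\<close> elements.
\<close>
lemma frobenius_add: "(x + y :: 'b) ^ (q ^ i) = x ^ (q ^ i) + y ^ (q ^ i)"
  by (rule freshmans_dream'[where n = "n * i"])
     (simp_all add: CHAR_algebra prime_p q_eq power_mult)

lemma frobenius_scale: "scale c x ^ (q ^ i) = scale c (x ^ (q ^ i))"
proof -
  have "c ^ (q ^ i) = c"
    using power_card_finite_field[where 'k = 'k] by (induction i) (simp_all add: power_mult card_constants)
  then show ?thesis by (simp add: scale_power)
qed

lemma span_insert_parametrization:
  assumes "b \<notin> span B"
  shows "bij_betw (\<lambda>(c, v). scale c b + v) (UNIV \<times> span B) (span (insert b B))"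
  unfolding bij_betw_def
proof
  show "inj_on (\<lambda>(c, v). scale c b + v) (UNIV \<times> span B)"
  proof (rule inj_onI, clarify)
    fix c v c' v'
    assume v: "v \<in> span B" "v' \<in> span B" and eq: "scale c b + v = scale c' b + v'"
    have "scale (c - c') b = v' - v" using eq by (simp add: scale_left_diff_distrib algebra_simps)
    then have "scale (c - c') b \<in> span B" using v by (simp add: span_diff)
    then have "c = c'"
      using assms span_scale[of "scale (c - c') b" B "inverse (c - c')"] by (cases "c = c'") auto
    then show "c = c' \<and> v = v'" using eq by simp
  qed
  show "(\<lambda>(c, v). scale c b + v) ` (UNIV \<times> span B) = span (insert b B)"
  proof (intro equalityI subsetI)
    fix y assume "y \<in> span (insert b B)"
    then obtain c where "y - scale c b \<in> span B" by (auto simp: span_breakdown_eq)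
    then show "y \<in> (\<lambda>(c, v). scale c b + v) ` (UNIV \<times> span B)"
      by (intro image_eqI[of _ _ "(c, y - scale c b)"]) auto
  next
    fix y assume "y \<in> (\<lambda>(c, v). scale c b + v) ` (UNIV \<times> span B)"
    then obtain c v where "v \<in> span B" and "y = scale c b + v" by auto
    then show "y \<in> span (insert b B)"
      by (auto simp: span_breakdown_eq intro!: exI[of _ c])
  qed
qed

lemma finite_span: "finite B \<Longrightarrow> independent B \<Longrightarrow> finite (span B)"
proof (induction B rule: finite_induct)
  case (insert b B)
  then have "b \<notin> span B" and "independent B" by (simp_all add: independent_insert)
  then show ?case
    using insert.IH bij_betw_finite[OF span_insert_parametrization[of b B]] by simp
qed simp

lemma card_span: "finite B \<Longrightarrow> independent B \<Longrightarrow> card (span B) = q ^ card B"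
proof (induction B rule: finite_induct)
  case (insert b B)
  then have "b \<notin> span B" and "independent B" by (simp_all add: independent_insert)
  then show ?case
    using insert.IH insert.hyps bij_betw_same_card[OF span_insert_parametrization[of b B]]
    by (simp add: card_cartesian_product card_constants)
qed simp

text \<open>
  In coordinates the product is a polynomial of degree at most \<open>card J\<close> in \<open>card B\<close> variables.
  A monomial in which some variable has exponent less than \<open>q - 1\<close> sums to \<open>0\<close> over the finite
  field, and the degree bound leaves no other monomial. The induction sums over one coordinate at
  a time: what survives has lost at least \<open>q - 1\<close> of its factors.
\<close>
lemma sum_span_prod_affine_eq_0:
  assumes "finite B" and "independent B" and "finite J"
    and "\<And>j x y. j \<in> J \<Longrightarrow> L j (x + y) = L j x + L j y"
    and "\<And>j c x. j \<in> J \<Longrightarrow> L j (scale c x) = scale c (L j x)"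
    and "card J < card B * (q - 1)"
  shows "(\<Sum>v\<in>span B. \<Prod>j\<in>J. f j + L j v) = 0"
  using assms
proof (induction B arbitrary: J rule: finite_induct)
  case (insert b B)
  then have b: "b \<notin> span B" and indep: "independent B" by (simp_all add: independent_insert)
  have "(\<Sum>v\<in>span (insert b B). \<Prod>j\<in>J. f j + L j v)
      = (\<Sum>(c, v)\<in>UNIV \<times> span B. \<Prod>j\<in>J. f j + L j (scale c b + v))"
    by (subst sum.reindex_bij_betw[OF span_insert_parametrization[OF b], symmetric])
       (simp add: case_prod_unfold)
  also have "\<dots> = (\<Sum>c\<in>UNIV. \<Sum>v\<in>span B. \<Prod>j\<in>J. (f j + L j v) + scale c (L j b))"
    unfolding sum.cartesian_product[symmetric]
    by (intro sum.cong prod.cong refl) (simp add: insert.prems algebra_simps)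
  also have "\<dots> = (\<Sum>c\<in>UNIV. \<Sum>v\<in>span B. \<Sum>X\<in>Pow J.
      (\<Prod>j\<in>X. f j + L j v) * scale (c ^ card (J - X)) (\<Prod>j\<in>J - X. L j b))"
    using insert.prems by (simp add: prod_add scale_prod)
  also have "\<dots> = (\<Sum>X\<in>Pow J. \<Sum>c\<in>UNIV. \<Sum>v\<in>span B.
      (\<Prod>j\<in>X. f j + L j v) * scale (c ^ card (J - X)) (\<Prod>j\<in>J - X. L j b))"
    by (simp only: sum.swap[of _ _ "Pow J"])
  also have "\<dots> = (\<Sum>X\<in>Pow J. (\<Sum>v\<in>span B. \<Prod>j\<in>X. f j + L j v) *
      scale (\<Sum>c\<in>UNIV. c ^ card (J - X)) (\<Prod>j\<in>J - X. L j b))"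
    by (simp add: sum_distrib_left sum_distrib_right scale_sum_left sum.swap[of _ UNIV])
  also have "\<dots> = 0"
  proof (rule sum.neutral, rule ballI)
    fix X assume X: "X \<in> Pow J"
    show "(\<Sum>v\<in>span B. \<Prod>j\<in>X. f j + L j v) *
      scale (\<Sum>c\<in>UNIV. c ^ card (J - X)) (\<Prod>j\<in>J - X. L j b) = 0"
    proof (cases "card (J - X) < q - 1")
      case True
      then have "(\<Sum>c\<in>(UNIV::'k set). c ^ card (J - X)) = 0"
        by (subst sum_power_finite_field) (auto simp: card_constants dest: dvd_imp_le)
      then show ?thesis by simp
    next
      case False
      have "finite X" using X insert.prems finite_subset by auto
      moreover have "card J = card X + card (J - X)"
        using X insert.prems \<open>finite X\<close> by (simp add: card_Diff_subset card_mono)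
      then have "card X < card B * (q - 1)"
        using False insert by (simp add: algebra_simps)
      ultimately have "(\<Sum>v\<in>span B. \<Prod>j\<in>X. f j + L j v) = 0"
        using X by (intro insert.IH indep) (auto intro: insert.prems)
      then show ?thesis by simp
    qed
  qed
  finally show ?case .
qed simp

text \<open>
  Writing \<open>s\<close> in base \<open>q\<close> turns the power into a product of \<open>digit_sum q s\<close> factors
  \<open>f ^ q ^ i + v ^ q ^ i\<close>, and the iterated Frobenius is linear in \<open>v\<close>.
\<close>
lemma sum_affine_power_eq_0:
  assumes "finite B" and "independent B" and "digit_sum q s < card B * (q - 1)"
  shows "(\<Sum>v\<in>span B. (f + v) ^ s) = 0"
proof -
  define J where "J = (SIGMA i:{..s}. {..<s div q ^ i mod q})"
  have "card J = digit_sum q s" by (simp add: J_def digit_sum_def)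
  have "(f + v) ^ s = (\<Prod>j\<in>J. f ^ (q ^ fst j) + v ^ (q ^ fst j))" for v
  proof -
    have "(f + v) ^ s = (f + v) ^ (\<Sum>i\<le>s. (s div q ^ i mod q) * q ^ i)"
      by (simp only: digit_expansion[OF q_ge_2])
    also have "\<dots> = (\<Prod>i\<le>s. \<Prod>t<s div q ^ i mod q. (f + v) ^ (q ^ i))"
      by (simp add: power_sum power_mult mult.commute[of _ "q ^ _"])
    also have "\<dots> = (\<Prod>j\<in>J. (f + v) ^ (q ^ fst j))"
      unfolding J_def by (subst prod.Sigma) (simp_all add: case_prod_unfold)
    finally show ?thesis by (simp add: frobenius_add)
  qed
  moreover have "(\<Sum>v\<in>span B. \<Prod>j\<in>J. f ^ (q ^ fst j) + v ^ (q ^ fst j)) = 0"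
    using assms \<open>card J = digit_sum q s\<close>
    by (intro sum_span_prod_affine_eq_0) (auto simp: J_def frobenius_add frobenius_scale)
  ultimately show ?thesis by simp
qed

end

section \<open>The zeta function of the polynomial ring\<close>

definition monic_polys :: "nat \<Rightarrow> 'k::field poly set" where
  "monic_polys i = {P. degree P = i \<and> lead_coeff P = 1}"

definition monic_power_sum :: "nat \<Rightarrow> nat \<Rightarrow> 'k::field poly" where
  "monic_power_sum i s = (\<Sum>P\<in>monic_polys i. P ^ s)"

lemma monic_polys_0: "monic_polys 0 = {1}"
  by (auto simp: monic_polys_def elim!: degree_eq_zeroE)

lemma monic_power_sum_0 [simp]: "monic_power_sum 0 s = 1"
  by (simp add: monic_power_sum_def monic_polys_0)

lemma monic_polys_Suc:
  "bij_betw (\<lambda>(c, P). pCons c P) (UNIV \<times> monic_polys i) (monic_polys (Suc i) :: 'k::field poly set)"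
  unfolding bij_betw_def
proof
  show "(\<lambda>(c, P). pCons c P) ` (UNIV \<times> monic_polys i) = (monic_polys (Suc i) :: 'k poly set)"
  proof (intro equalityI subsetI)
    fix Q :: "'k poly" assume Q: "Q \<in> monic_polys (Suc i)"
    obtain c P where "Q = pCons c P" by (cases Q)
    then show "Q \<in> (\<lambda>(c, P). pCons c P) ` (UNIV \<times> monic_polys i)"
      using Q by (intro image_eqI[of _ _ "(c, P)"]) (auto simp: monic_polys_def split: if_splits)
  qed (auto simp: monic_polys_def)
qed (auto simp: inj_on_def)

lemma card_monic_polys: "card (monic_polys i :: 'k::{field,finite} poly set) = card (UNIV :: 'k set) ^ i"
proof (induction i)
  case (Suc i)
  then show ?case
    using bij_betw_same_card[OF monic_polys_Suc[where 'k = 'k], of i]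
    by (simp add: card_cartesian_product)
qed (simp add: monic_polys_0)

text \<open>
  A monic polynomial of degree \<open>i + 1\<close> is \<open>c + T * P\<close> with \<open>P\<close> monic of degree \<open>i\<close>. Expanding
  its \<open>s\<close>-th power binomially and summing over the constant term \<open>c\<close> leaves the exponents
  \<open>s - j\<close> that are positive multiples of \<open>q - 1\<close>.
\<close>
lemma monic_power_sum_Suc:
  fixes s :: nat
  defines "q \<equiv> card (UNIV :: 'k::{field,finite} set)"
  shows "monic_power_sum (Suc i) s =
    - (\<Sum>j | j < s \<and> (q - 1) dvd (s - j).
        of_nat (s choose j) * monom 1 j * (monic_power_sum i j :: 'k poly))"
proof -
  let ?S = "monic_power_sum i :: nat \<Rightarrow> 'k poly"
  have const: "(\<Sum>c\<in>(UNIV::'k set). [:c:] ^ m) = (if m > 0 \<and> (q - 1) dvd m then - 1 else 0)" for m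
  proof -
    have "(\<Sum>c\<in>(UNIV::'k set). [:c:] ^ m) = [:\<Sum>c\<in>(UNIV::'k set). c ^ m:]"
      by (simp add: poly_const_pow sum_to_poly)
    then show ?thesis by (simp add: sum_power_finite_field q_def one_pCons)
  qed
  have expand: "pCons c P ^ s =
      (\<Sum>j\<le>s. of_nat (s choose j) * monom 1 j * P ^ j * [:c:] ^ (s - j))" for c and P :: "'k poly"
  proof -
    have "pCons c P = monom 1 1 * P + [:c:]"
      by (simp add: monom_altdef)
    then have "pCons c P ^ s = (\<Sum>j\<le>s. of_nat (s choose j) * (monom 1 1 * P) ^ j * [:c:] ^ (s - j))"
      by (simp only: binomial_ring)
    then show ?thesis by (simp add: power_mult_distrib monom_power mult.assoc)
  qed
  have "monic_power_sum (Suc i) s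
      = (\<Sum>(c, P)\<in>UNIV \<times> (monic_polys i :: 'k poly set). pCons c P ^ s)"
    unfolding monic_power_sum_def
    by (subst sum.reindex_bij_betw[OF monic_polys_Suc, symmetric]) (simp add: case_prod_unfold)
  also have "\<dots> = (\<Sum>c\<in>UNIV. \<Sum>P\<in>monic_polys i. \<Sum>j\<le>s.
      of_nat (s choose j) * monom 1 j * P ^ j * [:c:] ^ (s - j))"
    by (simp add: sum.cartesian_product[symmetric] expand)
  also have "\<dots> = (\<Sum>j\<le>s. \<Sum>c\<in>UNIV. \<Sum>P\<in>monic_polys i.
      of_nat (s choose j) * monom 1 j * P ^ j * [:c:] ^ (s - j))"
    by (simp only: sum.swap[of _ _ "{..s}"])
  also have "\<dots> = (\<Sum>j\<le>s. of_nat (s choose j) * monom 1 j * ?S j *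
      (\<Sum>c\<in>UNIV. [:c:] ^ (s - j)))"
    by (simp add: monic_power_sum_def sum_distrib_left sum_distrib_right sum.swap[of _ UNIV])
  also have "\<dots> = (\<Sum>j | j < s \<and> (q - 1) dvd (s - j).
      - (of_nat (s choose j) * monom 1 j * ?S j))"
    unfolding const by (rule sum.mono_neutral_cong_right) auto
  finally show ?thesis by (simp add: sum_negf)
qed

text \<open>
  Each step of the recursion lowers the exponent, so it reaches \<open>0\<close> before the degree does; this
  makes the zeta function at \<open>- s\<close> a polynomial.
\<close>
lemma monic_power_sum_eq_0:
  "s < i \<Longrightarrow> (monic_power_sum i s :: 'k::{field,finite} poly) = 0"
proof (induction i arbitrary: s)
  case (Suc i)
  then show ?case by (subst monic_power_sum_Suc) (simp add: sum.neutral)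
qed simp

lemma sum_monic_power_sum_exponent_0:
  "(\<Sum>i\<le>N. monic_power_sum i 0 :: 'k::{field,finite} poly) = 1"
  by (induction N) (simp_all add: monic_power_sum_eq_0)

text \<open>
  For \<open>N \<ge> s\<close> the weights \<open>f i = 1\<close> give the value of the zeta function at \<open>X = 1\<close>, and the weights
  \<open>f i = i\<close> give its derivative there.
\<close>
lemma sum_monic_power_sum_recursion:
  fixes s :: nat and f :: "nat \<Rightarrow> 'k::{field,finite} poly"
  defines "q \<equiv> card (UNIV :: 'k set)"
  shows "(\<Sum>i\<le>Suc N. f i * monic_power_sum i s) =
    f 0 - (\<Sum>j | j < s \<and> (q - 1) dvd (s - j).
        of_nat (s choose j) * monom 1 j * (\<Sum>i\<le>N. f (Suc i) * monic_power_sum i j))"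
  unfolding sum.atMost_Suc_shift
  by (simp add: monic_power_sum_Suc q_def sum_distrib_left sum_negf sum.swap[of _ "{..N}"] ac_simps)

text \<open>
  The trivial zero: in the recursion the exponent \<open>j = 0\<close> contributes \<open>1\<close>, which cancels the
  degree-zero term, and all the other exponents contribute \<open>0\<close> by induction.
\<close>
lemma sum_monic_power_sum_eq_0:
  assumes "s > 0" and "(card (UNIV :: 'k::{field,finite} set) - 1) dvd s" and "s \<le> N"
  shows "(\<Sum>i\<le>N. monic_power_sum i s :: 'k poly) = 0"
  using assms
proof (induction s arbitrary: N rule: less_induct)
  case (less s)
  let ?q = "card (UNIV :: 'k set)"
  let ?J = "{j. j < s \<and> (?q - 1) dvd (s - j)}"
  obtain M where M: "N = Suc M" using less.prems by (cases N) auto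
  have "(\<Sum>i\<le>N. monic_power_sum i s :: 'k poly) = 1 - (\<Sum>j\<in>?J.
      of_nat (s choose j) * monom 1 j * (\<Sum>i\<le>M. monic_power_sum i j))"
    using sum_monic_power_sum_recursion[of "\<lambda>_. 1 :: 'k poly" s M] by (simp add: M)
  also have "(\<Sum>j\<in>?J. of_nat (s choose j) * monom 1 j * (\<Sum>i\<le>M. monic_power_sum i j)) =
      (\<Sum>j\<in>{0}. of_nat (s choose j) * monom 1 j * (\<Sum>i\<le>M. monic_power_sum i j :: 'k poly))"
  proof (rule sum.mono_neutral_right)
    show "\<forall>j\<in>?J - {0}. of_nat (s choose j) * monom 1 j *
      (\<Sum>i\<le>M. monic_power_sum i j :: 'k poly) = 0"
    proof
      fix j assume j: "j \<in> ?J - {0}"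
      then have "(?q - 1) dvd j" using less.prems(2) dvd_diffD1[of "?q - 1" s j] by simp
      then have "(\<Sum>i\<le>M. monic_power_sum i j :: 'k poly) = 0"
        using j less.prems M by (intro less.IH) auto
      then show "of_nat (s choose j) * monom 1 j * (\<Sum>i\<le>M. monic_power_sum i j :: 'k poly) = 0"
        by simp
    qed
  qed (use less.prems in auto)
  finally show ?case by (simp add: sum_monic_power_sum_exponent_0 monom_0 one_pCons)
qed

text \<open>
  The trivial zero is simple: modulo \<open>T\<close> only the exponent \<open>j = 0\<close> survives in the recursion for
  the derivative, which is therefore congruent to \<open>- 1\<close>.
\<close>
lemma weighted_sum_monic_power_sum_neq_0:
  assumes "s > 0" and "(card (UNIV :: 'k::{field,finite} set) - 1) dvd s" and "s \<le> N"
  shows "(\<Sum>i\<le>N. of_nat i * monic_power_sum i s :: 'k poly) \<noteq> 0"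
proof -
  let ?q = "card (UNIV :: 'k set)"
  let ?J = "{j. j < s \<and> (?q - 1) dvd (s - j)}"
  obtain M where M: "N = Suc M" using assms by (cases N) auto
  have weight: "(\<Sum>i\<le>M. (1 + of_nat i) * monic_power_sum i 0 :: 'k poly) = 1"
  proof -
    have "(\<Sum>i\<le>M. of_nat i * monic_power_sum i 0 :: 'k poly) = 0"
      by (rule sum.neutral) (metis monic_power_sum_eq_0 mult_zero_left mult_zero_right neq0_conv of_nat_0)
    then show ?thesis
      by (simp add: distrib_right sum.distrib sum_monic_power_sum_exponent_0)
  qed
  have "poly (\<Sum>i\<le>N. of_nat i * monic_power_sum i s :: 'k poly) 0 =
      - (\<Sum>j\<in>?J. poly (of_nat (s choose j) * monom 1 j *
        (\<Sum>i\<le>M. (1 + of_nat i) * monic_power_sum i j)) 0)"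
    using sum_monic_power_sum_recursion[of "of_nat :: nat \<Rightarrow> 'k poly" s M]
    by (simp add: M poly_sum del: sum.atMost_Suc)
  also have "(\<Sum>j\<in>?J. poly (of_nat (s choose j) * monom 1 j *
        (\<Sum>i\<le>M. (1 + of_nat i) * monic_power_sum i j :: 'k poly)) 0) =
      (\<Sum>j\<in>{0}. poly (of_nat (s choose j) * monom 1 j *
        (\<Sum>i\<le>M. (1 + of_nat i) * monic_power_sum i j :: 'k poly)) 0)"
    using assms by (intro sum.mono_neutral_right) (auto simp: poly_monom zero_power)
  also have "\<dots> = 1" by (simp add: weight monom_0)
  finally show ?thesis by auto
qed

text \<open>
  The polynomial ring is one of the two algebras in which power sums vanish; the function field is
  the other one.
\<close>
lemma finite_field_algebra_smult:
  assumes "prime p" and "q = p ^ n" and "card (UNIV :: 'k::{field,finite} set) = q"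
  shows "finite_field_algebra (smult :: 'k \<Rightarrow> 'k poly \<Rightarrow> 'k poly) p n q"
  by unfold_locales (use assms in \<open>auto simp: smult_add_right smult_add_left\<close>)

text \<open>
  The monic polynomials of degree \<open>i\<close> form a translate of the \<open>i\<close>-dimensional space of polynomials
  of smaller degree.
\<close>
lemma monic_power_sum_eq_0_of_digit_sum:
  assumes "prime p" and "q = p ^ n" and "card (UNIV :: 'k::{field,finite} set) = q"
    and "digit_sum q s < i * (q - 1)"
  shows "(monic_power_sum i s :: 'k poly) = 0"
proof -
  interpret poly: finite_field_algebra "smult :: 'k \<Rightarrow> 'k poly \<Rightarrow> 'k poly" p n q
    by (rule finite_field_algebra_smult) fact+
  have basis: "\<exists>B :: 'k poly set. finite B \<and> poly.independent B \<and> card B = i \<and>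
      poly.span B = {P. \<forall>j\<ge>i. coeff P j = 0}" for i
  proof (induction i)
    case 0
    show ?case by (rule exI[of _ "{}"]) (auto simp: poly_eq_iff poly.independent_empty)
  next
    case (Suc i)
    then obtain B :: "'k poly set" where B: "finite B" "poly.independent B" "card B = i"
        "poly.span B = {P. \<forall>j\<ge>i. coeff P j = 0}" by blast
    have notin: "monom 1 i \<notin> poly.span B" by (auto simp: B(4))
    have "(\<forall>j\<ge>Suc i. coeff P j = 0) \<longleftrightarrow> (\<exists>c. \<forall>j\<ge>i. coeff (P - smult c (monom 1 i)) j = 0)"
      for P :: "'k poly"
    proof
      assume "\<forall>j\<ge>Suc i. coeff P j = 0"
      then have "coeff (P - smult (coeff P i) (monom 1 i)) j = 0" if "j \<ge> i" for j
        using that by (cases "j = i") simp_all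
      then show "\<exists>c. \<forall>j\<ge>i. coeff (P - smult c (monom 1 i)) j = 0" by blast
    next
      assume "\<exists>c. \<forall>j\<ge>i. coeff (P - smult c (monom 1 i)) j = 0"
      then obtain c where c: "\<And>j. j \<ge> i \<Longrightarrow> coeff (P - smult c (monom 1 i)) j = 0" by blast
      show "\<forall>j\<ge>Suc i. coeff P j = 0"
        using c by (metis (no_types) Suc_leD coeff_diff coeff_monom coeff_smult diff_zero
            mult_zero_right not_less_eq_eq order_refl)
    qed
    then have "poly.span (insert (monom 1 i) B) = {P. \<forall>j\<ge>Suc i. coeff P j = 0}"
      by (intro poly.span_insert_eqI) (simp add: B(4))
    moreover have "card (insert (monom 1 i) B) = Suc i"
      using B(1,3) notin poly.span_base[of "monom 1 i" B] by (metis card_insert_disjoint)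
    moreover have "finite (insert (monom 1 i) B)" using B(1) by simp
    ultimately show ?case using poly.independent_insertI[OF notin B(2)] by blast
  qed
  from basis[of i] obtain B :: "'k poly set" where B: "finite B" "poly.independent B" "card B = i"
      "poly.span B = {P. \<forall>j\<ge>i. coeff P j = 0}" by blast
  have "bij_betw (\<lambda>v. monom 1 i + v) (poly.span B) (monic_polys i)"
  proof (rule bij_betwI[where g = "\<lambda>P. P - monom 1 i"])
    have "degree P = i \<longleftrightarrow> (\<forall>j>i. coeff P j = 0)" if "coeff P i = 1" for P :: "'k poly"
      using that by (metis coeff_eq_0 degree_le le_antisym le_degree zero_neq_one)
    then have *: "P \<in> monic_polys i \<longleftrightarrow> coeff P i = 1 \<and> (\<forall>j>i. coeff P j = 0)" for P :: "'k poly"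
      by (auto simp: monic_polys_def)
    show "(\<lambda>v. monom 1 i + v) \<in> poly.span B \<rightarrow> monic_polys i"
      by (auto simp: * B(4))
    show "(\<lambda>P. P - monom 1 i) \<in> monic_polys i \<rightarrow> poly.span B"
      by (auto simp: * B(4) le_eq_less_or_eq)
  qed auto
  then have "monic_power_sum i s = (\<Sum>v\<in>poly.span B. (monom 1 i + v) ^ s)"
    unfolding monic_power_sum_def by (rule sum.reindex_bij_betw[symmetric])
  also have "\<dots> = 0"
    by (rule poly.sum_affine_power_eq_0) (use assms B in auto)
  finally show ?thesis .
qed

section \<open>Valuations\<close>

context function_field
begin

lemma emb_0: "\<iota> 0 = 0"
  using emb_add[of 0 0] unfolding add_0_left add_cancel_right_right .

lemma emb_minus: "\<iota> (- c) = - \<iota> c"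
  using emb_add[of c "- c"] by (simp add: emb_0 eq_neg_iff_add_eq_0 add.commute)

lemma emb_diff: "\<iota> (c - d) = \<iota> c - \<iota> d"
  using emb_add[of c "- d"] by (simp add: emb_minus)

lemma emb_eq_0_iff: "\<iota> c = 0 \<longleftrightarrow> c = 0"
proof
  assume "\<iota> c = 0"
  then show "c = 0"
    using emb_mult[of c "inverse c"] by (cases "c = 0") (auto simp: emb_one)
qed (simp add: emb_0)

context
  fixes v :: "'a \<Rightarrow> int"
  assumes v: "v \<in> places \<iota>"
begin

lemma place_emb: "c \<noteq> 0 \<Longrightarrow> v (\<iota> c) = 0"
  using v by (simp add: places_def)

lemma place_mult: "x \<noteq> 0 \<Longrightarrow> y \<noteq> 0 \<Longrightarrow> v (x * y) = v x + v y"
  using v by (simp add: places_def)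

lemma place_one: "v 1 = 0"
  using place_emb[of 1] by (simp add: emb_one)

lemma place_power: "x \<noteq> 0 \<Longrightarrow> v (x ^ m) = int m * v x"
  by (induction m) (simp_all add: place_one place_mult algebra_simps)

lemma place_inverse: "x \<noteq> 0 \<Longrightarrow> v (inverse x) = - v x"
  using place_mult[of x "inverse x"] by (simp add: place_one)

lemma place_powi: "x \<noteq> 0 \<Longrightarrow> v (x powi k) = k * v x"
  by (simp add: power_int_def place_power place_inverse)

lemma val_ge_mono: "val_ge v x m \<Longrightarrow> k \<le> m \<Longrightarrow> val_ge v x k"
  by (auto simp: val_ge_def)

lemma val_ge_add: "val_ge v x m \<Longrightarrow> val_ge v y m \<Longrightarrow> val_ge v (x + y) m"
proof -
  have min: "min (v x) (v y) \<le> v (x + y)" if "x \<noteq> 0" "y \<noteq> 0" "x + y \<noteq> 0"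
    using v that by (simp add: places_def)
  assume "val_ge v x m" and "val_ge v y m"
  then show ?thesis
    using min by (cases "x = 0 \<or> y = 0 \<or> x + y = 0") (auto simp: val_ge_def)
qed

lemma val_ge_mult: "val_ge v x m \<Longrightarrow> val_ge v y k \<Longrightarrow> val_ge v (x * y) (m + k)"
proof (cases "x = 0 \<or> y = 0")
  case True
  then show ?thesis by (auto simp: val_ge_def)
next
  case False
  then show "val_ge v x m \<Longrightarrow> val_ge v y k \<Longrightarrow> val_ge v (x * y) (m + k)"
    using place_mult[of x y] by (simp add: val_ge_def)
qed

lemma val_ge_emb: "val_ge v (\<iota> c) 0"
  by (cases "c = 0") (simp_all add: val_ge_def emb_0 place_emb)

lemma val_ge_scalar: "val_ge v x m \<Longrightarrow> val_ge v (\<iota> c * x) m"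
  using val_ge_mult[OF val_ge_emb, of x m c] by simp

lemma val_ge_diff: "val_ge v x m \<Longrightarrow> val_ge v y m \<Longrightarrow> val_ge v (x - y) m"
  using val_ge_add[of x m "- y"] val_ge_scalar[of y m "- 1"] by (simp add: emb_minus emb_one)

lemma val_ge_power: "val_ge v x 0 \<Longrightarrow> val_ge v (x ^ m) 0"
proof (induction m)
  case 0
  then show ?case using val_ge_emb[of 1] by (simp add: emb_one)
next
  case (Suc m)
  then show ?case using val_ge_mult[of x 0 "x ^ m" 0] by simp
qed

text \<open>
  In the ultrametric setting an error of higher valuation cannot change the valuation.
\<close>
lemma place_eq_of_dominant:
  assumes "y \<noteq> 0" and "val_ge v (x - y) (v y + 1)"
  shows "x \<noteq> 0" and "v x = v y"
proof -
  have notge: "\<not> val_ge v y (v y + 1)" using assms by (simp add: val_ge_def)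
  then have notge': "\<not> val_ge v x (v y + 1)"
    using val_ge_diff[OF _ assms(2), of x] by auto
  then show "x \<noteq> 0" by (auto simp: val_ge_def)
  have "val_ge v x (v y)"
    using val_ge_add[of "x - y" "v y" y] val_ge_mono[OF assms(2)] by (simp add: val_ge_def)
  then show "v x = v y" using notge' by (auto simp: val_ge_def)
qed

end

end

section \<open>Leading terms at a place of degree one\<close>

locale rational_place = function_field \<iota> for \<iota> :: "'k::{field,finite} \<Rightarrow> 'a::field" +
  fixes w :: "'a \<Rightarrow> int" and u :: 'a and p n q :: nat
  assumes w_place: "w \<in> places \<iota>" and w_degree: "place_degree \<iota> w = 1"
    and u_neq_0: "u \<noteq> 0" and w_u: "w u = 1"
    and p_prime: "prime p" and q_power: "q = p ^ n" and card_k: "card (UNIV :: 'k set) = q"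
begin

sublocale finite_field_algebra "scalar \<iota>" p n q
proof -
  interpret vector_space "scalar \<iota>" by (rule vector_space_scalar)
  show "finite_field_algebra (scalar \<iota>) p n q"
    by unfold_locales (simp_all add: p_prime q_power card_k[unfolded q_power])
qed

lemma w_powi: "w (u powi m) = m"
  by (simp add: place_powi[OF w_place u_neq_0] w_u)

text \<open>
  The residue field is one-dimensional and contains the residue classes of the constants.
\<close>
lemma residue_constant:
  assumes "val_ge w x 0"
  shows "\<exists>c. val_ge w (x - \<iota> c) 1"
proof -
  have "\<exists>B. residue_basis \<iota> w B \<and> card B = 1"
    using w_degree someI_ex[of "\<lambda>B. residue_basis \<iota> w B"]
    by (auto simp: place_degree_def split: if_splits)
  then obtain b where b: "residue_basis \<iota> w {b}" by (auto simp: card_1_singleton_iff)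
  have gen: "\<exists>c. val_ge w (y - \<iota> c * b) 1" if "val_ge w y 0" for y
  proof -
    obtain f where "val_ge w (y - (\<Sum>b\<in>{b}. \<iota> (f b) * b)) 1"
      using b \<open>val_ge w y 0\<close> unfolding residue_basis_def by blast
    then show ?thesis by auto
  qed
  have "val_ge w 1 0" using val_ge_emb[OF w_place, of 1] by (simp add: emb_one)
  then obtain c where c: "val_ge w (1 - \<iota> c * b) 1" using gen by blast
  obtain d where d: "val_ge w (x - \<iota> d * b) 1" using gen assms by blast
  have "c \<noteq> 0"
    using c by (auto simp: emb_0 val_ge_def place_one[OF w_place])
  then have "\<iota> (d / c) * \<iota> c = \<iota> d" by (simp flip: emb_mult)
  then have "x - \<iota> (d / c) = (x - \<iota> d * b) - \<iota> (d / c) * (1 - \<iota> c * b)"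
    by (simp add: algebra_simps flip: mult.assoc)
  then show ?thesis
    using val_ge_diff[OF w_place d val_ge_scalar[OF w_place c, of "d / c"]] by metis
qed

text \<open>
  The function \<open>x / b\<close> is regular at the place, and \<open>c\<close> is its residue.
\<close>
lemma leading_coefficient:
  assumes "val_ge w x (w b)" and "b \<noteq> 0"
  shows "\<exists>c. val_ge w (x - \<iota> c * b) (w b + 1)"
proof -
  have "val_ge w (inverse b) (- w b)"
    using assms by (simp add: val_ge_def place_inverse[OF w_place])
  then have "val_ge w (x * inverse b) 0"
    using val_ge_mult[OF w_place assms(1), of "inverse b" "- w b"] by simp
  then obtain c where "val_ge w (x * inverse b - \<iota> c) 1" using residue_constant by blast
  then have "val_ge w (b * (x * inverse b - \<iota> c)) (w b + 1)"
    by (intro val_ge_mult[OF w_place]) (simp_all add: val_ge_def)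
  moreover have "b * (x * inverse b - \<iota> c) = x - \<iota> c * b"
    using assms by (simp add: field_simps)
  ultimately show ?thesis by auto
qed

lemma leading_coefficient_unique:
  assumes "val_ge w (x - \<iota> c * b) (w b + 1)" and "val_ge w (x - \<iota> d * b) (w b + 1)" and "b \<noteq> 0"
  shows "c = d"
proof (rule ccontr)
  assume "c \<noteq> d"
  have "val_ge w ((x - \<iota> d * b) - (x - \<iota> c * b)) (w b + 1)"
    by (rule val_ge_diff[OF w_place assms(2,1)])
  also have "(x - \<iota> d * b) - (x - \<iota> c * b) = \<iota> (c - d) * b"
    by (simp add: emb_diff algebra_simps)
  finally show False
    using \<open>c \<noteq> d\<close> assms(3) by (simp add: val_ge_def emb_eq_0_iff place_mult[OF w_place] place_emb[OF w_place])
qed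

text \<open>
  Completing a leading term to a full expansion amounts to repeatedly subtracting leading terms.
\<close>
lemma expansion_exists:
  assumes "val_ge w (x - u powi m) (m + 1)"
  shows "\<exists>f. has_expansion \<iota> w u x f \<and> fls_subdegree f = m \<and> fls_nth f m = 1"
proof -
  have "\<exists>C. \<forall>y k. val_ge w y k \<longrightarrow> val_ge w (y - \<iota> (C y k) * u powi k) (k + 1)"
  proof (intro choice allI)
    fix y k
    show "\<exists>c. val_ge w y k \<longrightarrow> val_ge w (y - \<iota> c * u powi k) (k + 1)"
      using leading_coefficient[of y "u powi k"] u_neq_0 by (auto simp: w_powi)
  qed
  then obtain C where C: "\<And>y k. val_ge w y k \<Longrightarrow> val_ge w (y - \<iota> (C y k) * u powi k) (k + 1)"
    by blast
  \<comment> \<open>\<open>R k\<close> is what remains of \<open>x\<close> after subtracting its first \<open>k\<close> terms.\<close>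
  define R where "R = rec_nat x (\<lambda>k y. y - \<iota> (C y (m + int k)) * u powi (m + int k))"
  define c where "c k = C (R k) (m + int k)" for k
  have R_Suc: "R (Suc k) = R k - \<iota> (c k) * u powi (m + int k)" for k
    by (simp add: R_def c_def)
  have x: "val_ge w x m"
    using val_ge_add[OF w_place val_ge_mono[OF w_place assms, of m], of "u powi m"]
    by (simp add: val_ge_def w_powi)
  have R: "val_ge w (R k) (m + int k)" for k
  proof (induction k)
    case 0
    then show ?case using x by (simp add: R_def)
  next
    case (Suc k)
    have "m + int (Suc k) = m + int k + 1" by simp
    then show ?case using C[OF Suc.IH] unfolding R_Suc c_def by metis
  qed
  have "c 0 = 1"
  proof (rule leading_coefficient_unique[of x _ "u powi m"])
    show "val_ge w (x - \<iota> (c 0) * u powi m) (w (u powi m) + 1)"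
      using C[OF x] by (simp add: w_powi c_def R_def)
    show "val_ge w (x - \<iota> 1 * u powi m) (w (u powi m) + 1)"
      using assms by (simp add: w_powi emb_one)
  qed (simp add: u_neq_0)
  define f where "f = fls_shift (- m) (fps_to_fls (Abs_fps c))"
  have f_nth: "fls_nth f i = (if i < m then 0 else c (nat (i - m)))" for i
    by (auto simp: f_def)
  have f_deg: "fls_subdegree f = m"
    by (rule fls_subdegree_eqI) (simp_all add: f_nth \<open>c 0 = 1\<close>)
  have partial: "x - (\<Sum>i\<in>{m..<m + int k}. \<iota> (fls_nth f i) * u powi i) = R k" for k
  proof (induction k)
    case (Suc k)
    have "{m..<m + int (Suc k)} = insert (m + int k) {m..<m + int k}" by auto
    then show ?case using Suc by (simp add: R_Suc f_nth algebra_simps)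
  qed (simp add: R_def)
  have "has_expansion \<iota> w u x f"
    unfolding has_expansion_def f_deg
  proof
    fix N
    show "val_ge w (x - (\<Sum>i\<in>{m..<N}. \<iota> (fls_nth f i) * u powi i)) N"
    proof (cases "m \<le> N")
      case True
      then show ?thesis using R[of "nat (N - m)"] partial[of "nat (N - m)"] by simp
    next
      case False
      then show ?thesis using val_ge_mono[OF w_place x, of N] by simp
    qed
  qed
  then show ?thesis using f_deg by (auto simp: f_nth \<open>c 0 = 1\<close>)
qed

text \<open>
  This replaces the expansion in the completion by a condition on the leading term alone.
\<close>
lemma is_monic_iff:
  "is_monic \<iota> w u x \<and> w x = m \<longleftrightarrow> val_ge w (x - u powi m) (m + 1)"
proof
  assume "is_monic \<iota> w u x \<and> w x = m"
  then obtain f where f: "has_expansion \<iota> w u x f" "fls_nth f (fls_subdegree f) = 1"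
    and m: "w x = m" by (auto simp: is_monic_def)
  have "{fls_subdegree f..<fls_subdegree f + 1} = {fls_subdegree f}" by auto
  then have *: "val_ge w (x - u powi fls_subdegree f) (fls_subdegree f + 1)"
    using f(1)[unfolded has_expansion_def, rule_format, of "fls_subdegree f + 1"] f(2)
    by (simp add: emb_one)
  then have "w x = fls_subdegree f"
    using place_eq_of_dominant(2)[OF w_place, of "u powi fls_subdegree f" x] u_neq_0
    by (simp add: w_powi)
  then show "val_ge w (x - u powi m) (m + 1)" using * m by simp
next
  assume *: "val_ge w (x - u powi m) (m + 1)"
  then have "x \<noteq> 0" "w x = m"
    using place_eq_of_dominant[OF w_place, of "u powi m" x] u_neq_0 by (simp_all add: w_powi)
  moreover obtain f where "has_expansion \<iota> w u x f" "fls_subdegree f = m" "fls_nth f m = 1"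
    using expansion_exists[OF *] by blast
  ultimately show "is_monic \<iota> w u x \<and> w x = m" by (auto simp: is_monic_def)
qed

section \<open>The spaces of functions with poles only at the place\<close>

abbreviation A :: "'a set" where "A \<equiv> integral_ring \<iota> w"

lemma integral_add: "x \<in> A \<Longrightarrow> y \<in> A \<Longrightarrow> x + y \<in> A"
  by (auto simp: integral_ring_def intro: val_ge_add)

lemma integral_mult: "x \<in> A \<Longrightarrow> y \<in> A \<Longrightarrow> x * y \<in> A"
  unfolding integral_ring_def using val_ge_mult[of _ x 0 y 0] by auto

lemma integral_emb: "\<iota> c \<in> A"
  by (auto simp: integral_ring_def val_ge_emb)

lemma integral_diff: "x \<in> A \<Longrightarrow> y \<in> A \<Longrightarrow> x - y \<in> A"
  by (auto simp: integral_ring_def intro: val_ge_diff)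

lemma integral_power: "x \<in> A \<Longrightarrow> x ^ m \<in> A"
  by (auto simp: integral_ring_def intro: val_ge_power)

definition bounded_pole :: "int \<Rightarrow> 'a set" where
  "bounded_pole m = riemann_roch_space \<iota> (multiple_of_place m w)"

lemma bounded_pole_iff: "x \<in> bounded_pole m \<longleftrightarrow> x \<in> A \<and> val_ge w x (- m)"
  using w_place
  by (auto simp: bounded_pole_def riemann_roch_space_def multiple_of_place_def integral_ring_def)

text \<open>The complement in the natural numbers of the gap set of the place.\<close>
definition pole_orders :: "nat set" where
  "pole_orders = {j. \<exists>b\<in>A. b \<noteq> 0 \<and> w b = - int j}"

lemma zero_pole_order: "0 \<in> pole_orders"
  unfolding pole_orders_def
  using integral_emb[of 1] place_one[OF w_place] by (auto simp: emb_one intro!: bexI[of _ 1])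

lemma add_pole_orders: "i \<in> pole_orders \<Longrightarrow> j \<in> pole_orders \<Longrightarrow> i + j \<in> pole_orders"
proof -
  assume "i \<in> pole_orders" and "j \<in> pole_orders"
  then obtain a b where ab: "a \<in> A" "a \<noteq> 0" "w a = - int i" "b \<in> A" "b \<noteq> 0" "w b = - int j"
    by (auto simp: pole_orders_def)
  then have "w (a * b) = - int (i + j)" by (simp add: place_mult[OF w_place])
  moreover have "a * b \<in> A" and "a * b \<noteq> 0" using ab by (simp_all add: integral_mult)
  ultimately show ?thesis unfolding pole_orders_def by blast
qed

text \<open>
  The powers of a function without poles that vanishes at the place would be infinitely many
  elements of the same finite space.
\<close>
lemma bounded_pole_minus_1:
  assumes "finite (bounded_pole (int m))"
  shows "bounded_pole (- 1) = {0}"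
proof -
  have "f = 0" if f: "f \<in> bounded_pole (- 1)" for f
  proof (rule ccontr)
    assume "f \<noteq> 0"
    with f have wf: "w f \<ge> 1" and "f \<in> A" by (auto simp: bounded_pole_iff val_ge_def)
    have order: "w (f ^ k) = int k * w f" for k
      by (rule place_power[OF w_place \<open>f \<noteq> 0\<close>])
    have "f ^ k \<in> bounded_pole (int m)" for k
    proof -
      have "0 \<le> int k * w f" using wf by simp
      then show ?thesis
        using integral_power[OF \<open>f \<in> A\<close>] by (simp add: bounded_pole_iff val_ge_def order)
    qed
    then have "range (\<lambda>k. f ^ k) \<subseteq> bounded_pole (int m)" by auto
    moreover have "inj (\<lambda>k. f ^ k)"
    proof (rule injI)
      fix i j :: nat assume "f ^ i = f ^ j"
      then have "w (f ^ i) = w (f ^ j)" by simp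
      then show "i = j" using wf by (simp add: order)
    qed
    then have "infinite (range (\<lambda>k. f ^ k))" by (rule range_inj_infinite)
    ultimately show False using assms finite_subset by blast
  qed
  moreover have "0 \<in> bounded_pole (- 1)"
    by (simp add: bounded_pole_iff val_ge_def integral_ring_def)
  ultimately show ?thesis by blast
qed

text \<open>
  A space without a finite basis has dimension \<open>0\<close> by convention.
\<close>
lemma finite_of_dim_neq_0: "dim V \<noteq> 0 \<Longrightarrow> finite V"
proof -
  assume *: "dim V \<noteq> 0"
  have ex: "\<exists>b. independent b \<and> span b = span V"
    using * unfolding dim_def by presburger
  let ?B = "SOME b. independent b \<and> span b = span V"
  have B: "independent ?B \<and> span ?B = span V" using ex by (rule someI_ex)
  have "dim V = card ?B" unfolding dim_def using ex by (rule if_P)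
  then have "finite ?B" using * by (intro card_ge_0_finite) simp
  then have "finite (span V)" using finite_span[of ?B] B by simp
  then show "finite V" by (rule finite_subset[OF span_superset])
qed

lemma finite_bounded_pole_of_ell:
  "ell \<iota> (multiple_of_place m w) \<noteq> 0 \<Longrightarrow> finite (bounded_pole m)"
  using finite_of_dim_neq_0[of "bounded_pole m"] by (simp add: ell_def bounded_pole_def)

end

text \<open>
  No nonzero function without poles elsewhere vanishes at the place. This makes the filtration by
  pole order start at \<open>0\<close>, so that every space in it is finite.
\<close>
locale finite_rational_place = rational_place \<iota> w u p n q
  for \<iota> :: "'k::{field,finite} \<Rightarrow> 'a::field" and w u p n q +
  assumes bounded_pole_neg: "bounded_pole (- 1) = {0}"
begin

text \<open>
  Raising the admissible pole order to \<open>m\<close> adds one dimension if \<open>m\<close> is the pole order of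
  some function, because two functions with that pole order have proportional leading terms.
\<close>
lemma bounded_pole_basis:
  "\<exists>B. finite B \<and> independent B \<and> card B = card {j \<in> pole_orders. j < m} \<and>
    span B = bounded_pole (int m - 1)"
proof (induction m)
  case 0
  show ?case by (rule exI[of _ "{}"]) (simp add: bounded_pole_neg independent_empty)
next
  case (Suc m)
  then obtain B where B: "finite B" "independent B" "card B = card {j \<in> pole_orders. j < m}"
    "span B = bounded_pole (int m - 1)" by blast
  show ?case
  proof (cases "m \<in> pole_orders")
    case False
    then have "bounded_pole (int m) = bounded_pole (int m - 1)"
      by (fastforce simp: bounded_pole_iff val_ge_def pole_orders_def)
    moreover have "{j \<in> pole_orders. j < Suc m} = {j \<in> pole_orders. j < m}"
      using False by (auto simp: less_Suc_eq)
    ultimately show ?thesis using B by auto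
  next
    case True
    then obtain b where b: "b \<in> A" "b \<noteq> 0" "w b = - int m" by (auto simp: pole_orders_def)
    have notin: "b \<notin> span B" using b by (auto simp: B(4) bounded_pole_iff val_ge_def)
    have "y \<in> bounded_pole (int m) \<longleftrightarrow> (\<exists>c. y - \<iota> c * b \<in> span B)" for y
    proof
      assume y: "y \<in> bounded_pole (int m)"
      then obtain c where "val_ge w (y - \<iota> c * b) (- int m + 1)"
        using leading_coefficient[of y b] b by (auto simp: bounded_pole_iff)
      then show "\<exists>c. y - \<iota> c * b \<in> span B"
        using y b by (auto simp: B(4) bounded_pole_iff intro!: integral_diff integral_mult integral_emb)
    next
      assume "\<exists>c. y - \<iota> c * b \<in> span B"
      then obtain c where c: "y - \<iota> c * b \<in> A" "val_ge w (y - \<iota> c * b) (- int m + 1)"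
        by (auto simp: B(4) bounded_pole_iff)
      have "val_ge w (\<iota> c * b) (- int m)"
        using b by (intro val_ge_scalar[OF w_place]) (simp add: val_ge_def)
      then have "val_ge w ((y - \<iota> c * b) + \<iota> c * b) (- int m)"
        using val_ge_mono[OF w_place c(2)] by (intro val_ge_add[OF w_place]) simp_all
      moreover have "(y - \<iota> c * b) + \<iota> c * b \<in> A"
        by (intro integral_add integral_mult integral_emb b c)
      ultimately show "y \<in> bounded_pole (int m)" by (simp add: bounded_pole_iff)
    qed
    then have "span (insert b B) = bounded_pole (int (Suc m) - 1)"
      using span_insert_eqI[of "bounded_pole (int m)" b B] by simp
    moreover have "{j \<in> pole_orders. j < Suc m} = insert m {j \<in> pole_orders. j < m}"
      using True by (auto simp: less_Suc_eq)
    then have "card (insert b B) = card {j \<in> pole_orders. j < Suc m}"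
    proof -
      have "b \<notin> B" using notin span_base by blast
      then have "card (insert b B) = Suc (card B)" using B(1) by simp
      also have "\<dots> = card (insert m {j \<in> pole_orders. j < m})" by (simp add: B(3))
      finally show ?thesis using \<open>{j \<in> pole_orders. j < Suc m} = _\<close> by simp
    qed
    moreover have "finite (insert b B)" using B(1) by simp
    ultimately show ?thesis using independent_insertI[OF notin B(2)] by blast
  qed
qed

lemma ell_multiple_of_place:
  "ell \<iota> (multiple_of_place (int m) w) = card {j \<in> pole_orders. j \<le> m}"
proof -
  obtain B where "finite B" "independent B" "card B = card {j \<in> pole_orders. j < Suc m}"
    "span B = bounded_pole (int (Suc m) - 1)" using bounded_pole_basis by blast
  then show ?thesis
    using dim_span_eq_card_independent[of B] by (simp add: ell_def bounded_pole_def less_Suc_eq_le)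
qed

definition monic_elements :: "nat \<Rightarrow> 'a set" where
  "monic_elements d = {a \<in> A. - w a = int d \<and> is_monic \<iota> w u a}"

lemma monic_elements_iff:
  "a \<in> monic_elements d \<longleftrightarrow> a \<in> A \<and> val_ge w (a - u powi (- int d)) (- int d + 1)"
  using is_monic_iff[of a "- int d"] by (auto simp: monic_elements_def)

lemma monic_elements_nonempty:
  assumes "d \<in> pole_orders"
  shows "\<exists>b. b \<in> monic_elements d"
proof -
  obtain b where b: "b \<in> A" "b \<noteq> 0" "w b = - int d" using assms by (auto simp: pole_orders_def)
  have "val_ge w (u powi (- int d)) (w b)" by (simp add: val_ge_def w_powi b)
  then obtain c where c: "val_ge w (u powi (- int d) - \<iota> c * b) (- int d + 1)"
    using leading_coefficient[of "u powi (- int d)" b] b by auto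
  have "val_ge w (\<iota> c * b - u powi (- int d)) (- int d + 1)"
    using val_ge_scalar[OF w_place c, of "- 1"] by (simp add: emb_minus emb_one)
  then show ?thesis using b by (auto simp: monic_elements_iff intro!: integral_mult integral_emb)
qed

lemma pole_order_of_monic_elements: "monic_elements d \<noteq> {} \<Longrightarrow> d \<in> pole_orders"
  by (auto simp: monic_elements_def is_monic_def pole_orders_def)

text \<open>
  Two functions with the same leading term differ by one with a pole of smaller order.
\<close>
lemma monic_elements_translate:
  assumes b: "b \<in> monic_elements d"
  shows "bij_betw (\<lambda>v. b + v) (bounded_pole (int d - 1)) (monic_elements d)"
proof (rule bij_betwI[where g = "\<lambda>a. a - b"])
  show "(\<lambda>v. b + v) \<in> bounded_pole (int d - 1) \<rightarrow> monic_elements d"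
  proof
    fix v assume "v \<in> bounded_pole (int d - 1)"
    then have "v \<in> A" "val_ge w v (- int d + 1)" by (auto simp: bounded_pole_iff)
    then show "b + v \<in> monic_elements d"
      using b val_ge_add[OF w_place, of "b - u powi (- int d)" "- int d + 1" v]
      by (auto simp: monic_elements_iff algebra_simps intro: integral_add)
  qed
  show "(\<lambda>a. a - b) \<in> monic_elements d \<rightarrow> bounded_pole (int d - 1)"
  proof
    fix a assume "a \<in> monic_elements d"
    then show "a - b \<in> bounded_pole (int d - 1)"
      using b val_ge_diff[OF w_place, of "a - u powi (- int d)" "- int d + 1" "b - u powi (- int d)"]
      by (auto simp: monic_elements_iff bounded_pole_iff intro: integral_diff)
  qed
qed auto

text \<open>
  The monic elements of degree \<open>d\<close> form a translate of a space whose dimension is the number of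
  pole orders less than \<open>d\<close>.
\<close>
lemma sum_power_monic_elements_eq_0:
  assumes "digit_sum q s < card {j \<in> pole_orders. j < d} * (q - 1)"
  shows "(\<Sum>a\<in>monic_elements d. a ^ s) = 0"
proof (cases "d \<in> pole_orders")
  case True
  then obtain b where b: "b \<in> monic_elements d" using monic_elements_nonempty by blast
  obtain B where B: "finite B" "independent B" "card B = card {j \<in> pole_orders. j < d}"
    "span B = bounded_pole (int d - 1)" using bounded_pole_basis by blast
  have "(\<Sum>a\<in>monic_elements d. a ^ s) = (\<Sum>v\<in>span B. (b + v) ^ s)"
    unfolding B(4) by (rule sum.reindex_bij_betw[OF monic_elements_translate[OF b], symmetric])
  also have "\<dots> = 0" by (rule sum_affine_power_eq_0) (use assms B in auto)
  finally show ?thesis .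
next
  case False
  then have "monic_elements d = {}" using pole_order_of_monic_elements by blast
  then show ?thesis by simp
qed

lemma card_monic_elements:
  assumes "d \<in> pole_orders"
  shows "card (monic_elements d) = q ^ card {j \<in> pole_orders. j < d}"
proof -
  obtain b where b: "b \<in> monic_elements d" using monic_elements_nonempty assms by blast
  obtain B where B: "finite B" "independent B" "card B = card {j \<in> pole_orders. j < d}"
    "span B = bounded_pole (int d - 1)" using bounded_pole_basis by blast
  show ?thesis
    using bij_betw_same_card[OF monic_elements_translate[OF b]] card_span[OF B(1,2)] B(3,4) by simp
qed

lemma monic_elements_mult:
  assumes "a \<in> monic_elements d" and "b \<in> monic_elements e"
  shows "a * b \<in> monic_elements (d + e)"
proof -
  have a: "a \<in> A" "val_ge w (a - u powi (- int d)) (- int d + 1)"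
    using assms(1) unfolding monic_elements_iff by simp_all
  have "w b = - int e" "b \<noteq> 0"
    using assms(2) by (simp_all add: monic_elements_def is_monic_def)
  moreover have "b \<in> A" "val_ge w (b - u powi (- int e)) (- int e + 1)"
    using assms(2) unfolding monic_elements_iff by simp_all
  ultimately have b: "b \<in> A" "w b = - int e" "b \<noteq> 0"
      "val_ge w (b - u powi (- int e)) (- int e + 1)"
    by simp_all
  have "val_ge w b (- int e)" using b by (simp add: val_ge_def)
  then have "val_ge w ((a - u powi (- int d)) * b) ((- int d + 1) + - int e)"
    by (rule val_ge_mult[OF w_place a(2)])
  moreover have "val_ge w (u powi (- int d)) (- int d)" by (simp add: val_ge_def w_powi)
  then have "val_ge w (u powi (- int d) * (b - u powi (- int e))) (- int d + (- int e + 1))"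
    using b(4) by (rule val_ge_mult[OF w_place])
  ultimately have "val_ge w ((a - u powi (- int d)) * b + u powi (- int d) * (b - u powi (- int e)))
      (- int (d + e) + 1)"
    by (intro val_ge_add[OF w_place]) (simp_all add: algebra_simps)
  also have "(a - u powi (- int d)) * b + u powi (- int d) * (b - u powi (- int e)) =
      a * b - u powi (- int d) * u powi (- int e)"
    by (simp only: left_diff_distrib right_diff_distrib diff_add_cancel diff_add_eq add_diff_eq)
  also have "u powi (- int d) * u powi (- int e) = u powi (- int (d + e))"
  proof -
    have "- int (d + e) = - int d + - int e" by simp
    then show ?thesis using power_int_add[of u "- int d" "- int e"] u_neq_0 by metis
  qed
  finally show ?thesis
    using integral_mult[OF a(1) b(1)] unfolding monic_elements_iff by blast
qed

end

section \<open>Polynomials in one function\<close>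

context function_field
begin

definition eval_at :: "'a \<Rightarrow> 'k poly \<Rightarrow> 'a" where
  "eval_at x P = poly (map_poly \<iota> P) x"

lemma eval_at_0: "eval_at x 0 = 0"
  by (simp add: eval_at_def)

lemma eval_at_pCons: "eval_at x (pCons c P) = \<iota> c + x * eval_at x P"
  by (simp add: eval_at_def map_poly_pCons emb_0)

lemma eval_at_1: "eval_at x 1 = 1"
  by (simp add: one_pCons eval_at_pCons eval_at_0 emb_one)

lemma eval_at_add: "eval_at x (P + Q) = eval_at x P + eval_at x Q"
  by (induction P Q rule: poly_induct2) (simp_all add: eval_at_0 eval_at_pCons emb_add algebra_simps)

lemma eval_at_smult: "eval_at x (smult c P) = \<iota> c * eval_at x P"
  by (induction P) (simp_all add: eval_at_0 eval_at_pCons emb_mult algebra_simps)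

lemma eval_at_diff: "eval_at x (P - Q) = eval_at x P - eval_at x Q"
  using eval_at_add[of x P "smult (- 1) Q"] eval_at_smult[of x "- 1" Q]
  by (simp add: emb_minus emb_one)

lemma eval_at_mult: "eval_at x (P * Q) = eval_at x P * eval_at x Q"
  by (induction P)
     (simp_all add: eval_at_0 eval_at_pCons eval_at_add eval_at_smult emb_0 algebra_simps)

lemma eval_at_power: "eval_at x (P ^ m) = eval_at x P ^ m"
  by (induction m) (simp_all add: eval_at_1 eval_at_mult)

lemma eval_at_sum: "eval_at x (\<Sum>i\<in>I. f i) = (\<Sum>i\<in>I. eval_at x (f i))"
  by (induction I rule: infinite_finite_induct) (simp_all add: eval_at_0 eval_at_add)

lemma eval_at_of_nat: "eval_at x (of_nat m) = of_nat m"
  by (induction m) (simp_all add: eval_at_0 eval_at_1 eval_at_add)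

end

context finite_rational_place
begin

lemma monic_elements_add_lower:
  assumes "a \<in> monic_elements d" and "v \<in> bounded_pole (int d - 1)"
  shows "a + v \<in> monic_elements d"
  using bij_betw_apply[OF monic_elements_translate[OF assms(1)] assms(2)] .

lemma finite_monic_elements: "finite (monic_elements d)"
proof (cases "d \<in> pole_orders")
  case True
  then show ?thesis using card_monic_elements[OF True] q_ge_2 by (intro card_ge_0_finite) simp
next
  case False
  then have "monic_elements d = {}" using pole_order_of_monic_elements by blast
  then show ?thesis by simp
qed

context
  fixes x :: 'a
  assumes x: "x \<in> monic_elements q"
begin

text \<open>
  In \<open>c + x * Q x\<close> the constant \<open>c\<close> does not affect the leading term, since \<open>x\<close> has a pole.
\<close>
lemma eval_at_monic:
  "P \<in> monic_polys i \<Longrightarrow> eval_at x P \<in> monic_elements (i * q)"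
proof (induction i arbitrary: P)
  case 0
  then have "eval_at x P = 1" by (simp add: monic_polys_0 eval_at_1)
  moreover have "1 \<in> A" using integral_emb[of 1] by (simp add: emb_one)
  ultimately show ?case by (simp add: monic_elements_iff val_ge_def)
next
  case (Suc i)
  then obtain c Q where Q: "P = pCons c Q" "Q \<in> monic_polys i"
    using bij_betw_imp_surj_on[OF monic_polys_Suc[of i]] by force
  have "x * eval_at x Q \<in> monic_elements (Suc i * q)"
    using monic_elements_mult[OF x Suc.IH[OF Q(2)]] by simp
  moreover have "\<iota> c \<in> bounded_pole (int (Suc i * q) - 1)"
  proof -
    have "0 < Suc i * q" using q_ge_2 by simp
    then have "- (int (Suc i * q) - 1) \<le> 0" by linarith
    then show ?thesis
      using val_ge_mono[OF w_place val_ge_emb[OF w_place]] integral_emb by (simp add: bounded_pole_iff)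
  qed
  ultimately have "x * eval_at x Q + \<iota> c \<in> monic_elements (Suc i * q)"
    by (rule monic_elements_add_lower)
  then show ?case by (simp add: Q(1) eval_at_pCons add.commute)
qed

text \<open>The function \<open>x\<close> is transcendental, since a polynomial in it has a pole of known order.\<close>
lemma eval_at_eq_0_iff: "eval_at x P = 0 \<longleftrightarrow> P = 0"
proof
  assume eq: "eval_at x P = 0"
  show "P = 0"
  proof (rule ccontr)
    assume "P \<noteq> 0"
    then have "smult (inverse (lead_coeff P)) P \<in> monic_polys (degree P)"
      by (simp add: monic_polys_def)
    then have "eval_at x (smult (inverse (lead_coeff P)) P) \<in> monic_elements (degree P * q)"
      by (rule eval_at_monic)
    then show False using eq by (simp add: eval_at_smult monic_elements_def is_monic_def)
  qed
qed (simp add: eval_at_0)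

text \<open>
  If there are only \<open>i\<close> smaller pole orders, the two sides of the inclusion
  \<open>eval_at x ` monic_polys i \<subseteq> monic_elements (i * q)\<close> have the same number \<open>q ^ i\<close> of elements.
\<close>
lemma sum_power_monic_elements_eq_eval_at:
  assumes "card {j \<in> pole_orders. j < i * q} = i" and "i * q \<in> pole_orders"
  shows "(\<Sum>a\<in>monic_elements (i * q). a ^ s) = eval_at x (monic_power_sum i s)"
proof -
  have inj: "inj_on (eval_at x) (monic_polys i)"
    by (rule inj_onI) (metis eval_at_diff eval_at_eq_0_iff right_minus_eq)
  have "eval_at x ` monic_polys i = monic_elements (i * q)"
  proof (rule card_subset_eq)
    show "eval_at x ` monic_polys i \<subseteq> monic_elements (i * q)" using eval_at_monic by blast
    show "card (eval_at x ` monic_polys i) = card (monic_elements (i * q))"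
      using assms by (simp add: card_image[OF inj] card_monic_polys card_monic_elements card_k)
  qed (rule finite_monic_elements)
  then have "(\<Sum>a\<in>monic_elements (i * q). a ^ s) = (\<Sum>P\<in>monic_polys i. eval_at x P ^ s)"
    using sum.reindex[OF inj, of "\<lambda>a. a ^ s"] by simp
  then show ?thesis by (simp add: monic_power_sum_def eval_at_sum eval_at_power)
qed

end

lemma zeta_coefficient: "fps_nth (zeta \<iota> w u (- int s)) d = (\<Sum>a\<in>monic_elements d. a ^ s)"
  by (simp add: zeta_def monic_elements_def power_int_minus divide_inverse)

end

section \<open>The order of vanishing\<close>

text \<open>
  With a positive element \<open>m < q\<close>, the semigroup would contain the \<open>r + 2\<close> multiples
  \<open>0, m, \<dots>, (r + 1) * m\<close>, and all of them are at most \<open>r * q\<close> because \<open>q - 1 \<le> r\<close>. Hence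
  \<open>q\<close> is in it, and the multiples of \<open>q\<close> up to \<open>r * q\<close> leave no room for other elements up to \<open>N\<close>.
\<close>
lemma semigroup_of_multiples:
  fixes S :: "nat set" and q r N :: nat
  assumes zero: "0 \<in> S" and add: "\<And>i j. i \<in> S \<Longrightarrow> j \<in> S \<Longrightarrow> i + j \<in> S"
    and card_q: "card {j \<in> S. j \<le> q} = 2"
    and card_rq: "card {j \<in> S. j \<le> r * q} = r + 1"
    and card_N: "card {j \<in> S. j \<le> N} = r + 1"
    and "r * q \<le> N" and "q > 0" and "q - 1 \<le> r"
  shows "{j \<in> S. j \<le> N} = (\<lambda>i. i * q) ` {..r}"
proof -
  have mult: "m \<in> S \<Longrightarrow> i * m \<in> S" for i m
    by (induction i) (auto intro: zero add)
  have "\<not> {j \<in> S. j \<le> q} \<subseteq> {0}"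
    using card_mono[of "{0::nat}" "{j \<in> S. j \<le> q}"] card_q by auto
  then obtain m where m: "m \<in> S" "m \<le> q" "m > 0" by auto
  have "m = q"
  proof (rule ccontr)
    assume "m \<noteq> q"
    then have "(r + 1) * m \<le> (r + 1) * (q - 1)" using m by (intro mult_left_mono) auto
    also have "\<dots> \<le> r * q"
      using \<open>q - 1 \<le> r\<close> \<open>q > 0\<close> by (cases q) auto
    finally have "i * m \<le> r * q" if "i \<le> r + 1" for i
      using that by (meson le_trans mult_le_mono1)
    then have "(\<lambda>i. i * m) ` {..r + 1} \<subseteq> {j \<in> S. j \<le> r * q}"
      using m mult by auto
    then have "card ((\<lambda>i. i * m) ` {..r + 1}) \<le> r + 1"
      using card_mono[of "{j \<in> S. j \<le> r * q}"] card_rq by simp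
    moreover have "card ((\<lambda>i. i * m) ` {..r + 1}) = r + 2"
      using m by (subst card_image) (auto simp: inj_on_def)
    ultimately show False by simp
  qed
  have "i * q \<le> N" if "i \<le> r" for i
    using that \<open>r * q \<le> N\<close> by (meson le_trans mult_le_mono1)
  then have "(\<lambda>i. i * q) ` {..r} \<subseteq> {j \<in> S. j \<le> N}"
    using m mult \<open>m = q\<close> by auto
  moreover have "card ((\<lambda>i. i * q) ` {..r}) = r + 1"
    using \<open>q > 0\<close> by (subst card_image) (auto simp: inj_on_def)
  ultimately show ?thesis
    using card_N by (intro card_subset_eq[symmetric]) auto
qed

text \<open>
  Over a field of characteristic \<open>p\<close> the factor \<open>X - 1\<close> of \<open>Y\<close> becomes
  \<open>X ^ q - 1 = (X - 1) ^ q\<close>: a simple zero turns into a zero of order exactly \<open>q\<close>.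
\<close>
lemma order_1_pcompose_frobenius:
  fixes Y :: "'a::field poly"
  assumes "prime CHAR('a)" and "q = CHAR('a) ^ n"
    and "poly Y 1 = 0" and "poly (pderiv Y) 1 \<noteq> 0"
  shows "pcompose Y (monom 1 q) \<noteq> 0" and "order 1 (pcompose Y (monom 1 q)) = q"
proof -
  obtain U where U: "Y = [:- 1, 1:] * U"
    using assms(3) by (auto simp: poly_eq_0_iff_dvd)
  have "poly U 1 \<noteq> 0" using assms(4) unfolding U pderiv_mult by (simp add: pderiv_pCons)
  then have U1: "poly (pcompose U (monom 1 q)) 1 \<noteq> 0" by (simp add: poly_pcompose poly_monom)
  have "[:- 1, 1:] ^ q + 1 ^ q = ([:- 1, 1:] + 1 :: 'a poly) ^ q"
    by (rule freshmans_dream'[where n = n, symmetric]) (simp_all add: assms(1,2))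
  also have "[:- 1, 1:] + 1 = (monom 1 1 :: 'a poly)" by (simp add: one_pCons monom_altdef)
  finally have "monom 1 q - 1 = ([:- 1, 1:] ^ q :: 'a poly)" 
    by (simp only: monom_power power_one mult_1_left flip: eq_diff_eq)
  moreover have "pcompose [:- 1, 1:] (monom 1 q) = (monom 1 q - 1 :: 'a poly)"
    by (simp add: pcompose_pCons one_pCons)
  ultimately have linear: "pcompose [:- 1, 1:] (monom 1 q) = ([:- 1, 1:] ^ q :: 'a poly)"
    by (rule trans[rotated])
  have *: "pcompose Y (monom 1 q) = [:- 1, 1:] ^ q * pcompose U (monom 1 q)"
    unfolding U pcompose_mult linear ..
  have "pcompose U (monom 1 q) \<noteq> 0" using U1 by auto
  then show nz: "pcompose Y (monom 1 q) \<noteq> 0" by (simp add: *)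
  then show "order 1 (pcompose Y (monom 1 q)) = q"
    using U1 unfolding * by (simp add: order_mult order_power_n_n order_0I)
qed

theorem theorem7:
  fixes \<iota> :: "'k::{field,finite} \<Rightarrow> 'a::field"
    and w :: "'a \<Rightarrow> int" and u :: 'a
    and p n q g r s :: nat
  assumes "prime p" and "n > 0" and "q = p ^ n"
    and "card (UNIV :: 'k set) = q"
    and "function_field \<iota>"
    and "has_genus \<iota> g"
    and "w \<in> places \<iota>" and "place_degree \<iota> w = 1"
    and "u \<noteq> 0" and "w u = 1"
    and "gap_structure \<iota> w q g r" and "r \<ge> q - 1"
    and "s > 0" and "(q - 1) dvd s"
    and "real (digit_sum q s) / real (q - 1) \<le> real r"
  shows "vanishing_order_at_1 (zeta \<iota> w u (- int s)) q"
proof -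
  interpret function_field \<iota> by fact
  interpret rational_place \<iota> w u p n q by unfold_locales fact+
  have "r \<ge> 1" using q_ge_2 \<open>r \<ge> q - 1\<close> by linarith
  have ell_iq: "ell \<iota> (multiple_of_place (int (i * q)) w) = i + 1" if "1 \<le> i" "i \<le> r" for i
    using \<open>gap_structure \<iota> w q g r\<close> that by (simp add: gap_structure_def)
  have "finite (bounded_pole (int (1 * q)))"
    by (rule finite_bounded_pole_of_ell) (subst ell_iq, use \<open>r \<ge> 1\<close> in simp_all)
  then interpret finite_rational_place \<iota> w u p n q
    by unfold_locales (rule bounded_pole_minus_1)
  have s_bound: "digit_sum q s \<le> r * (q - 1)"
  proof -
    have "real (digit_sum q s) \<le> real r * real (q - 1)"
      using assms(15) q_ge_2 by (simp add: pos_divide_le_eq)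
    then show ?thesis by (metis of_nat_le_iff of_nat_mult)
  qed
  then have r_bound: "digit_sum q s < (r + 1) * (q - 1)"
    using q_ge_2 by (simp add: le_less_trans)
  let ?N = "g + r"
  have rq: "r * q \<le> ?N" using \<open>gap_structure \<iota> w q g r\<close> by (simp add: gap_structure_def)
  have pole_orders_below: "{j \<in> pole_orders. j \<le> ?N} = (\<lambda>i. i * q) ` {..r}"
  proof (rule semigroup_of_multiples)
    show "card {j \<in> pole_orders. j \<le> q} = 2"
      using ell_iq[of 1] \<open>r \<ge> 1\<close> ell_multiple_of_place[of q] by simp
    show "card {j \<in> pole_orders. j \<le> r * q} = r + 1"
      using ell_iq[of r] \<open>r \<ge> 1\<close> ell_multiple_of_place[of "r * q"] by simp
    show "card {j \<in> pole_orders. j \<le> ?N} = r + 1"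
      using \<open>gap_structure \<iota> w q g r\<close> ell_multiple_of_place[of ?N] by (simp add: gap_structure_def)
  qed (use rq q_ge_2 \<open>r \<ge> q - 1\<close> zero_pole_order add_pole_orders in auto)
  have iq_le: "i * q \<le> ?N" if "i \<le> r" for i
    using that rq by (meson le_trans mult_le_mono1)
  have iq_pole_order: "i * q \<in> pole_orders" if "i \<le> r" for i
    using that pole_orders_below by blast
  have count_below: "card {j \<in> pole_orders. j < i * q} = i" if "i \<le> r" for i
  proof -
    have "{j \<in> pole_orders. j < i * q} = {j \<in> {j \<in> pole_orders. j \<le> ?N}. j < i * q}"
      using iq_le[OF that] by auto
    also have "\<dots> = (\<lambda>i. i * q) ` {..<i}"
      unfolding pole_orders_below using that q_ge_2 by auto
    also have "card \<dots> = i" using q_ge_2 by (subst card_image) (auto simp: inj_on_def)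
    finally show ?thesis .
  qed
  obtain x where x: "x \<in> monic_elements q"
    using monic_elements_nonempty iq_pole_order[of 1] \<open>r \<ge> 1\<close> by auto
  define a where "a i = eval_at x (monic_power_sum i s)" for i
  define Y where "Y = (\<Sum>i\<le>r. monom (a i) i)"
  have at_multiple: "(\<Sum>b\<in>monic_elements (i * q). b ^ s) = a i" if "i \<le> r" for i
    unfolding a_def using that
    by (intro sum_power_monic_elements_eq_eval_at[OF x] count_below iq_pole_order)
  have elsewhere: "(\<Sum>b\<in>monic_elements d. b ^ s) = 0" if d: "d \<notin> (\<lambda>i. i * q) ` {..r}" for d
  proof (cases "d \<le> ?N")
    case True
    then have "d \<notin> pole_orders" using d pole_orders_below by blast
    then have "monic_elements d = {}" using pole_order_of_monic_elements by blast
    then show ?thesis by simp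
  next
    case False
    have "r + 1 = card {j \<in> pole_orders. j \<le> ?N}"
      unfolding pole_orders_below using q_ge_2 by (subst card_image) (auto simp: inj_on_def)
    also have "\<dots> \<le> card {j \<in> pole_orders. j < d}" using False by (intro card_mono) auto
    finally have "(r + 1) * (q - 1) \<le> card {j \<in> pole_orders. j < d} * (q - 1)"
      by (rule mult_right_mono) simp
    then have "digit_sum q s < card {j \<in> pole_orders. j < d} * (q - 1)"
      using r_bound by linarith
    then show ?thesis by (rule sum_power_monic_elements_eq_0)
  qed
  have compose: "pcompose Y (monom 1 q) = (\<Sum>i\<le>r. monom (a i) (i * q))"
  proof -
    have "pcompose (monom c i) (monom 1 q) = monom c (i * q)" for c :: 'a and i
      by (induction i) (simp_all add: monom_0 monom_Suc pcompose_pCons mult_monom)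
    then show ?thesis by (simp add: Y_def pcompose_sum)
  qed
  have "zeta \<iota> w u (- int s) = fps_of_poly (pcompose Y (monom 1 q))"
  proof (rule fps_ext)
    fix d
    have "fps_nth (fps_of_poly (pcompose Y (monom 1 q))) d = (\<Sum>i\<le>r. if i * q = d then a i else 0)"
      by (simp add: compose coeff_sum)
    also have "\<dots> = (\<Sum>b\<in>monic_elements d. b ^ s)"
    proof (cases "d \<in> (\<lambda>i. i * q) ` {..r}")
      case True
      then obtain i where i: "i \<le> r" "d = i * q" by auto
      have "(\<Sum>j\<le>r. if j * q = d then a j else 0) = (\<Sum>j\<le>r. if j = i then a j else 0)"
        using q_ge_2 by (intro sum.cong) (auto simp: i)
      then show ?thesis using i at_multiple by simp
    next
      case False
      then have "(\<Sum>i\<le>r. if i * q = d then a i else 0) = 0" by (intro sum.neutral) auto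
      then show ?thesis using elsewhere[OF False] by simp
    qed
    finally show "fps_nth (zeta \<iota> w u (- int s)) d =
        fps_nth (fps_of_poly (pcompose Y (monom 1 q))) d"
      by (simp add: zeta_coefficient)
  qed
  moreover have "pcompose Y (monom 1 q) \<noteq> 0" and "order 1 (pcompose Y (monom 1 q)) = q"
  proof -
    \<comment> \<open>The sums over \<open>i \<le> r\<close> must be extended to \<open>i \<le> s\<close> to reach the whole zeta function of \<open>k[T]\<close>.\<close>
    let ?M = "max r s"
    have vanish: "monic_power_sum i s = (0 :: 'k poly)" if "i > r" for i
    proof (rule monic_power_sum_eq_0_of_digit_sum[OF p_prime q_power card_k])
      have "(r + 1) * (q - 1) \<le> i * (q - 1)" using that by (intro mult_right_mono) auto
      then show "digit_sum q s < i * (q - 1)" using r_bound by linarith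
    qed
    have "(\<Sum>i\<le>r. monic_power_sum i s :: 'k poly) = (\<Sum>i\<le>?M. monic_power_sum i s)"
      by (rule sum.mono_neutral_left) (auto simp: vanish)
    also have "\<dots> = 0"
      by (rule sum_monic_power_sum_eq_0) (use assms in \<open>auto simp: card_k\<close>)
    finally have root: "poly Y 1 = 0"
      by (simp add: Y_def poly_sum poly_monom a_def eval_at_0 flip: eval_at_sum)
    have "(\<Sum>i\<le>r. of_nat i * monic_power_sum i s :: 'k poly) = (\<Sum>i\<le>?M. of_nat i * monic_power_sum i s)"
      by (rule sum.mono_neutral_left) (auto simp: vanish)
    also have "\<dots> \<noteq> 0"
      by (rule weighted_sum_monic_power_sum_neq_0) (use assms in \<open>auto simp: card_k\<close>)
    finally have "eval_at x (\<Sum>i\<le>r. of_nat i * monic_power_sum i s) \<noteq> 0"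
      by (simp add: eval_at_eq_0_iff[OF x])
    then have simple: "poly (pderiv Y) 1 \<noteq> 0"
      by (simp add: Y_def higher_pderiv_sum[of 1, simplified] pderiv_monom poly_sum poly_monom a_def
          eval_at_sum eval_at_mult eval_at_of_nat)
    have "prime CHAR('a)" and "q = CHAR('a) ^ n"
      using p_prime q_power by (simp_all add: CHAR_algebra)
    then show "pcompose Y (monom 1 q) \<noteq> 0" and "order 1 (pcompose Y (monom 1 q)) = q"
      using order_1_pcompose_frobenius root simple by blast+
  qed
  ultimately show ?thesis unfolding vanishing_order_at_1_def by blast
qed

end
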